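(* Let $r\ge 2$ and $L\ge 2$ be integers, let $G_1,\dots,G_r$ be finite groups with $|G_1|=\dots=|G_r|=L$, let $\mathcal A=G_1*\cdots*G_r$, and let $\mathcal X=\mathrm{Cay}(\mathcal A,S)$ with $S=\bigsqcup_{i=1}^r(G_i\setminus\{e\})$. The spectrum of the Laplacian $\mathcal L_{\mathcal X}$ on $\ell^2(\mathcal A)$ consists of the interval $$\Big[1-\frac{L-2+2\sqrt{(r-1)(L-1)}}{r(L-1)},\ 1-\frac{L-2-2\sqrt{(r-1)(L-1)}}{r(L-1)}\Big]$$ and, when $L>r$, the point $\frac{L}{L-1}$.
   Context: The normalized Laplacian of the Cayley graph $\mathcal X$ is the bounded self-adjoint operator on $\ell^2(\mathcal A)$ defined by $$(\mathcal L_{\mathcal X}f)(x)=f(x)-\frac1{|S|}\sum_{a\in S}f(xa),\quad x\in\mathcal A .$$ *)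

theory Defs
  imports "HOL-Analysis.Analysis" "HOL-Algebra.Coset"
begin

section \<open>Free products of groups\<close>

text \<open>
  The elements of the free product of the groups \<open>G i\<close>, \<open>i \<in> I\<close>, are the reduced words: lists of
  syllables \<open>(i, x)\<close> with \<open>i \<in> I\<close> and \<open>x\<close> a nontrivial element of \<open>G i\<close>, in which neighbouring
  syllables come from different factors.  The product of two words is the reduced form of their
  concatenation.  The results at the end of this section show that this is a group with the
  universal property of the coproduct.
\<close>

definition reduced_words :: "'i set \<Rightarrow> ('i \<Rightarrow> ('a, 'b) monoid_scheme) \<Rightarrow> ('i \<times> 'a) list set" where
  "reduced_words I G =
     {w. (\<forall>(i, x) \<in> set w. i \<in> I \<and> x \<in> carrier (G i) \<and> x \<noteq> \<one>\<^bsub>G i\<^esub>) \<and>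
         distinct_adj (map fst w)}"

text \<open>Left multiplication of a reduced word by an element of one factor, with reduction.\<close>

fun syllable_mult ::
  "('i \<Rightarrow> ('a, 'b) monoid_scheme) \<Rightarrow> 'i \<times> 'a \<Rightarrow> ('i \<times> 'a) list \<Rightarrow> ('i \<times> 'a) list" where
  "syllable_mult G (i, x) [] = (if x = \<one>\<^bsub>G i\<^esub> then [] else [(i, x)])"
| "syllable_mult G (i, x) ((j, y) # w) =
     (if x = \<one>\<^bsub>G i\<^esub> then (j, y) # w
      else if i = j then
        (if x \<otimes>\<^bsub>G i\<^esub> y = \<one>\<^bsub>G i\<^esub> then w else (i, x \<otimes>\<^bsub>G i\<^esub> y) # w)
      else (i, x) # (j, y) # w)"

definition free_product ::
  "'i set \<Rightarrow> ('i \<Rightarrow> ('a, 'b) monoid_scheme) \<Rightarrow> ('i \<times> 'a) list monoid" where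
  "free_product I G =
     \<lparr>carrier = reduced_words I G, mult = (\<lambda>u v. foldr (syllable_mult G) u v), one = []\<rparr>"

definition free_product_inj ::
  "('i \<Rightarrow> ('a, 'b) monoid_scheme) \<Rightarrow> 'i \<Rightarrow> 'a \<Rightarrow> ('i \<times> 'a) list" where
  "free_product_inj G i x = (if x = \<one>\<^bsub>G i\<^esub> then [] else [(i, x)])"

lemma reduced_words_Nil [simp]: "[] \<in> reduced_words I G"
  by (simp add: reduced_words_def)

lemma reduced_words_Cons:
  "(i, x) # w \<in> reduced_words I G \<longleftrightarrow>
     i \<in> I \<and> x \<in> carrier (G i) \<and> x \<noteq> \<one>\<^bsub>G i\<^esub> \<and> w \<in> reduced_words I G \<and>
     (w = [] \<or> fst (hd w) \<noteq> i)"
  by (cases w) (auto simp: reduced_words_def)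

context
  fixes I :: "'i set" and G :: "'i \<Rightarrow> ('a, 'b) monoid_scheme"
  assumes grp: "\<And>i. i \<in> I \<Longrightarrow> group (G i)"
begin

lemma syllable_mult_closed:
  assumes "i \<in> I" "x \<in> carrier (G i)" "w \<in> reduced_words I G"
  shows "syllable_mult G (i, x) w \<in> reduced_words I G"
proof -
  interpret group "G i" using grp assms(1) .
  show ?thesis using assms
    by (cases w) (auto simp: reduced_words_Cons)
qed

lemma syllable_mult_mult:
  assumes "i \<in> I" "x \<in> carrier (G i)" "y \<in> carrier (G i)" "w \<in> reduced_words I G"
  shows "syllable_mult G (i, x) (syllable_mult G (i, y) w) = syllable_mult G (i, x \<otimes>\<^bsub>G i\<^esub> y) w"
proof -
  interpret group "G i" using grp assms(1) .
  show ?thesis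
  proof (cases w)
    case Nil
    then show ?thesis using assms by auto
  next
    case (Cons p v)
    obtain j z where p: "p = (j, z)" by (cases p)
    show ?thesis
    proof (cases "i = j")
      case False
      then show ?thesis using assms Cons p by auto
    next
      case True
      have z: "z \<in> carrier (G i)" "z \<noteq> \<one>\<^bsub>G i\<^esub>" and v: "v = [] \<or> fst (hd v) \<noteq> i"
        using assms Cons p True by (auto simp: reduced_words_Cons)
      have head: "syllable_mult G (i, a) v = (if a = \<one>\<^bsub>G i\<^esub> then v else (i, a) # v)" for a
        using v by (cases v) auto
      have w: "w = syllable_mult G (i, z) v" using Cons p True z head[of z] by simp
      have collapse: "syllable_mult G (i, a) (syllable_mult G (i, b) v)
          = syllable_mult G (i, a \<otimes>\<^bsub>G i\<^esub> b) v"
        if "a \<in> carrier (G i)" "b \<in> carrier (G i)" for a b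
        using that by (cases "b = \<one>\<^bsub>G i\<^esub>"; cases "a = \<one>\<^bsub>G i\<^esub>") (simp_all add: head)
      show ?thesis
        using assms z by (simp add: w collapse m_assoc)
    qed
  qed
qed

lemma syllable_mult_one: "syllable_mult G (i, \<one>\<^bsub>G i\<^esub>) w = w"
  by (cases w) auto

lemma foldr_closed:
  assumes "u \<in> reduced_words I G" "w \<in> reduced_words I G"
  shows "foldr (syllable_mult G) u w \<in> reduced_words I G"
  using assms
proof (induction u)
  case (Cons p u)
  then show ?case
    by (cases p) (auto simp: reduced_words_Cons intro!: syllable_mult_closed)
qed simp

lemma foldr_syllable_mult:
  assumes "i \<in> I" "x \<in> carrier (G i)" "u \<in> reduced_words I G" "w \<in> reduced_words I G"
  shows "foldr (syllable_mult G) (syllable_mult G (i, x) u) w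
           = syllable_mult G (i, x) (foldr (syllable_mult G) u w)"
proof -
  interpret group "G i" using grp assms(1) .
  show ?thesis
  proof (cases u)
    case Nil
    then show ?thesis by (simp add: syllable_mult_one)
  next
    case (Cons p v)
    obtain j z where p: "p = (j, z)" by (cases p)
    have v: "v \<in> reduced_words I G" using assms Cons p by (simp add: reduced_words_Cons)
    have z: "j \<in> I" "z \<in> carrier (G j)" using assms Cons p by (simp_all add: reduced_words_Cons)
    show ?thesis
    proof (cases "i = j")
      case True
      have "syllable_mult G (i, x) (syllable_mult G (i, z) (foldr (syllable_mult G) v w))
              = syllable_mult G (i, x \<otimes>\<^bsub>G i\<^esub> z) (foldr (syllable_mult G) v w)"
        using syllable_mult_mult foldr_closed v assms z True by simp
      then show ?thesis using Cons p True assms z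
        by (auto simp: syllable_mult_one)
    next
      case False
      then show ?thesis using Cons p by (auto simp: syllable_mult_one)
    qed
  qed
qed

lemma foldr_syllable_mult_assoc:
  assumes "u \<in> reduced_words I G" "v \<in> reduced_words I G" "w \<in> reduced_words I G"
  shows "foldr (syllable_mult G) (foldr (syllable_mult G) u v) w
           = foldr (syllable_mult G) u (foldr (syllable_mult G) v w)"
  using assms(1)
proof (induction u)
  case (Cons p u)
  obtain i a where p: "p = (i, a)" by (cases p)
  with Cons assms show ?case
    by (simp add: reduced_words_Cons foldr_syllable_mult foldr_closed)
qed simp

lemma foldr_left_inverse:
  assumes "w \<in> reduced_words I G"
  shows "\<exists>u \<in> reduced_words I G. foldr (syllable_mult G) u w = []"
  using assms
proof (induction w)
  case Nil
  show ?case by (rule bexI[of _ "[]"]) auto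
next
  case (Cons p w)
  obtain i a where p: "p = (i, a)" by (cases p)
  have i: "i \<in> I" "a \<in> carrier (G i)" "a \<noteq> \<one>\<^bsub>G i\<^esub>" "w \<in> reduced_words I G"
    using Cons(2) p by (simp_all add: reduced_words_Cons)
  interpret group "G i" using grp i(1) .
  obtain u where u: "u \<in> reduced_words I G" "foldr (syllable_mult G) u w = []"
    using Cons(1)[OF i(4)] by (elim bexE)
  have inv1: "inv\<^bsub>G i\<^esub> a \<noteq> \<one>\<^bsub>G i\<^esub>" using i by simp
  let ?b = "[(i, inv\<^bsub>G i\<^esub> a)]"
  have b: "?b \<in> reduced_words I G" using i inv1 by (simp add: reduced_words_Cons)
  have bw: "foldr (syllable_mult G) ?b (p # w) = w"
    using i inv1 p by simp
  have "foldr (syllable_mult G) (foldr (syllable_mult G) u ?b) (p # w)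
      = foldr (syllable_mult G) u (foldr (syllable_mult G) ?b (p # w))"
    using u(1) b Cons(2) by (rule foldr_syllable_mult_assoc)
  also have "\<dots> = []" unfolding bw by (rule u(2))
  finally show ?case using foldr_closed[OF u(1) b] by (intro bexI)
qed

lemma free_product_group: "group (free_product I G)"
  by (rule groupI)
     (simp_all add: free_product_def foldr_closed foldr_syllable_mult_assoc foldr_left_inverse)

lemma free_product_inj_hom:
  assumes "i \<in> I"
  shows "free_product_inj G i \<in> hom (G i) (free_product I G)"
proof -
  interpret group "G i" using grp assms .
  show ?thesis
    using assms
    by (intro homI) (auto simp: free_product_def free_product_inj_def reduced_words_Cons)
qed

theorem free_product_universal:
  assumes H: "group H" and \<phi>: "\<And>i. i \<in> I \<Longrightarrow> \<phi> i \<in> hom (G i) H"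
  shows "\<exists>\<Phi> \<in> hom (free_product I G) H.
           (\<forall>i\<in>I. \<forall>x\<in>carrier (G i). \<Phi> (free_product_inj G i x) = \<phi> i x) \<and>
           (\<forall>\<Psi> \<in> hom (free_product I G) H.
              (\<forall>i\<in>I. \<forall>x\<in>carrier (G i). \<Psi> (free_product_inj G i x) = \<phi> i x) \<longrightarrow>
              (\<forall>w\<in>carrier (free_product I G). \<Psi> w = \<Phi> w))"
proof -
  interpret H: group H by fact
  define \<Phi> where "\<Phi> w = foldr (\<lambda>(i, x) h. \<phi> i x \<otimes>\<^bsub>H\<^esub> h) w \<one>\<^bsub>H\<^esub>" for w
  have \<Phi>_simps: "\<Phi> [] = \<one>\<^bsub>H\<^esub>" "\<Phi> ((i, x) # w) = \<phi> i x \<otimes>\<^bsub>H\<^esub> \<Phi> w" for i x w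
    by (simp_all add: \<Phi>_def)
  have \<phi>c: "\<phi> i x \<in> carrier H" if "i \<in> I" "x \<in> carrier (G i)" for i x
    using \<phi> that by (auto simp: hom_def)
  have \<phi>m: "\<phi> i (x \<otimes>\<^bsub>G i\<^esub> y) = \<phi> i x \<otimes>\<^bsub>H\<^esub> \<phi> i y"
    if "i \<in> I" "x \<in> carrier (G i)" "y \<in> carrier (G i)" for i x y
    using \<phi> that by (auto simp: hom_def)
  have \<phi>1: "\<phi> i \<one>\<^bsub>G i\<^esub> = \<one>\<^bsub>H\<^esub>" if "i \<in> I" for i
    using \<phi>[OF that] grp[OF that] H by (rule hom_one)
  have \<Phi>c: "\<Phi> w \<in> carrier H" if "w \<in> reduced_words I G" for w
    using that
  proof (induction w)
    case (Cons p w)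
    then show ?case by (cases p) (auto simp: \<Phi>_simps reduced_words_Cons \<phi>c)
  qed (simp add: \<Phi>_simps)
  have step: "\<Phi> (syllable_mult G (i, x) w) = \<phi> i x \<otimes>\<^bsub>H\<^esub> \<Phi> w"
    if ix: "i \<in> I" "x \<in> carrier (G i)" and w: "w \<in> reduced_words I G" for i x w
  proof (cases w)
    case Nil
    then show ?thesis using ix by (auto simp: \<Phi>_simps \<phi>c \<phi>1)
  next
    case (Cons p v)
    obtain j y where p: "p = (j, y)" by (cases p)
    have y: "j \<in> I" "y \<in> carrier (G j)" "v \<in> reduced_words I G"
      using w Cons p by (auto simp: reduced_words_Cons)
    have "\<phi> i x \<otimes>\<^bsub>H\<^esub> (\<phi> i y \<otimes>\<^bsub>H\<^esub> \<Phi> v) = \<phi> i (x \<otimes>\<^bsub>G i\<^esub> y) \<otimes>\<^bsub>H\<^esub> \<Phi> v" if "i = j"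
      using ix y that by (simp add: \<phi>m \<phi>c \<Phi>c H.m_assoc)
    then show ?thesis
      using Cons p y ix by (auto simp: \<Phi>_simps \<phi>c \<Phi>c \<phi>1)
  qed
  have mult: "\<Phi> (foldr (syllable_mult G) u w) = \<Phi> u \<otimes>\<^bsub>H\<^esub> \<Phi> w"
    if "u \<in> reduced_words I G" "w \<in> reduced_words I G" for u w
    using that
  proof (induction u)
    case Nil
    then show ?case by (simp add: \<Phi>_simps \<Phi>c)
  next
    case (Cons p u)
    then show ?case
      by (cases p) (simp add: \<Phi>_simps reduced_words_Cons step foldr_closed \<phi>c \<Phi>c H.m_assoc)
  qed
  have hom: "\<Phi> \<in> hom (free_product I G) H"
    by (rule homI) (auto simp: free_product_def \<Phi>c mult)
  have ext: "\<Phi> (free_product_inj G i x) = \<phi> i x" if "i \<in> I" "x \<in> carrier (G i)" for i x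
    using that by (simp add: free_product_inj_def \<Phi>_simps \<phi>1 \<phi>c)
  have uniq: "\<Psi> w = \<Phi> w"
    if \<Psi>: "\<Psi> \<in> hom (free_product I G) H"
      and e: "\<forall>i\<in>I. \<forall>x\<in>carrier (G i). \<Psi> (free_product_inj G i x) = \<phi> i x"
      and "w \<in> reduced_words I G" for \<Psi> w
    using that(3)
  proof (induction w)
    case Nil
    have "\<Psi> \<one>\<^bsub>free_product I G\<^esub> = \<one>\<^bsub>H\<^esub>"
      using \<Psi> free_product_group H by (rule hom_one)
    then show ?case by (simp add: free_product_def \<Phi>_simps)
  next
    case (Cons p w)
    obtain i x where p: "p = (i, x)" by (cases p)
    have ix: "i \<in> I" "x \<in> carrier (G i)" "x \<noteq> \<one>\<^bsub>G i\<^esub>" "w \<in> reduced_words I G"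
      using Cons(2) p by (auto simp: reduced_words_Cons)
    have inj: "free_product_inj G i x \<in> reduced_words I G"
      using ix by (simp add: free_product_inj_def reduced_words_Cons)
    have "p # w = free_product_inj G i x \<otimes>\<^bsub>free_product I G\<^esub> w"
      using Cons(2) p ix
      by (cases w) (auto simp: free_product_def free_product_inj_def reduced_words_Cons)
    then have "\<Psi> (p # w) = \<Psi> (free_product_inj G i x) \<otimes>\<^bsub>H\<^esub> \<Psi> w"
      using \<Psi> inj ix by (simp add: hom_def free_product_def)
    then show ?case using Cons(1) ix e p by (simp add: \<Phi>_simps)
  qed
  show ?thesis
    using hom ext uniq by (intro bexI[of _ \<Phi>]) (auto simp: free_product_def)
qed

end


section \<open>Bounded operators on \<open>\<ell>\<^sup>2\<close> and their spectrum\<close>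

text \<open>
  \<open>\<ell>\<^sup>2(X)\<close> is represented by the functions on the ambient type that vanish outside \<open>X\<close>, so that
  distinct representatives are distinct elements of \<open>\<ell>\<^sup>2(X)\<close>.
\<close>

definition ell2 :: "'x set \<Rightarrow> ('x \<Rightarrow> complex) set" where
  "ell2 X = {f. (\<forall>x. x \<notin> X \<longrightarrow> f x = 0) \<and> (\<lambda>x. (cmod (f x))\<^sup>2) summable_on X}"

definition ell2_norm :: "'x set \<Rightarrow> ('x \<Rightarrow> complex) \<Rightarrow> real" where
  "ell2_norm X f = sqrt (\<Sum>\<^sub>\<infinity>x\<in>X. (cmod (f x))\<^sup>2)"

definition bounded_operator :: "'x set \<Rightarrow> (('x \<Rightarrow> complex) \<Rightarrow> ('x \<Rightarrow> complex)) \<Rightarrow> bool" where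
  "bounded_operator X T \<longleftrightarrow>
     (\<forall>f \<in> ell2 X. T f \<in> ell2 X) \<and>
     (\<forall>f \<in> ell2 X. \<forall>g \<in> ell2 X. T (\<lambda>x. f x + g x) = (\<lambda>x. T f x + T g x)) \<and>
     (\<forall>c. \<forall>f \<in> ell2 X. T (\<lambda>x. c * f x) = (\<lambda>x. c * T f x)) \<and>
     (\<exists>K. \<forall>f \<in> ell2 X. ell2_norm X (T f) \<le> K * ell2_norm X f)"

text \<open>\<open>z\<close> is in the spectrum of \<open>T\<close> iff \<open>T - z\<close> has no bounded two-sided inverse on \<open>\<ell>\<^sup>2(X)\<close>.\<close>

definition operator_spectrum ::
  "'x set \<Rightarrow> (('x \<Rightarrow> complex) \<Rightarrow> ('x \<Rightarrow> complex)) \<Rightarrow> complex set" where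
  "operator_spectrum X T =
     {z. \<not> (\<exists>R. bounded_operator X R \<and>
               (\<forall>f \<in> ell2 X. R (\<lambda>x. T f x - z * f x) = f) \<and>
               (\<forall>f \<in> ell2 X. (\<lambda>x. T (R f) x - z * R f x) = f))}"


section \<open>The normalized Laplacian of a Cayley graph\<close>

definition cayley_laplacian ::
  "('x, 'b) monoid_scheme \<Rightarrow> 'x set \<Rightarrow> ('x \<Rightarrow> complex) \<Rightarrow> ('x \<Rightarrow> complex)" where
  "cayley_laplacian A S f =
     (\<lambda>x. if x \<in> carrier A
          then f x - 1 / of_nat (card S) * (\<Sum>a\<in>S. f (x \<otimes>\<^bsub>A\<^esub> a))
          else 0)"

definition free_product_generators ::
  "'i set \<Rightarrow> ('i \<Rightarrow> ('a, 'b) monoid_scheme) \<Rightarrow> ('i \<times> 'a) list set" where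
  "free_product_generators I G =
     (\<Union>i\<in>I. free_product_inj G i ` (carrier (G i) - {\<one>\<^bsub>G i\<^esub>}))"

end

theory Submission
  imports Defs
begin

text \<open>
  The Cayley graph is a tree of cliques: the cliques are the cosets \<open>x G\<^sub>i\<close>, each with \<open>L\<close> vertices, and
  every vertex lies in \<open>r\<close> of them.  Write \<open>p = r - 1\<close> and \<open>q = L - 1\<close>, let \<open>P i\<close> replace a function by
  its sums over the cosets of \<open>G\<^sub>i\<close>, and let \<open>T = \<Sum>i. P i\<close>.  Then the adjacency operator is \<open>T - r\<close>, and
  the Laplacian is the affine image \<open>1 - (T - r) / (r q)\<close> (\<open>laplacian_T\<close>).  The claim becomes that the
  spectrum of \<open>T\<close> is \<open>[(\<surd>p - \<surd>q)\<^sup>2, (\<surd>p + \<surd>q)\<^sup>2]\<close>, together with \<open>0\<close> when \<open>p < q\<close> (\<open>T_spectrum\<close>).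

  A point is in the spectrum of a bounded symmetric operator \<open>T\<close> exactly if \<open>T - z\<close> is not bounded
  below (\<open>symmetric_spectrum\<close>), so that both inclusions are statements about norms.

  Nothing else is in the spectrum.  Every clique has one vertex nearest to the identity, its stem, and
  \<open>q\<close> further ones; every vertex except the identity is the stem of \<open>p\<close> cliques and a further vertex of
  one.  Since \<open>\<langle>T f, f\<rangle>\<close> is the sum over the cliques of \<open>\<bar>\<Sum> f\<bar>\<^sup>2\<close>, Young's inequality between the stem
  and the further vertices, with the parameter \<open>\<surd>(q / p)\<close>, yields \<open>T \<le> (\<surd>p + \<surd>q)\<^sup>2\<close> (\<open>T_upper\<close>) and,
  for \<open>q \<le> p\<close>, \<open>T \<ge> (\<surd>p - \<surd>q)\<^sup>2\<close> (\<open>T_lower\<close>).  For \<open>p < q\<close> the operator \<open>T\<close> is only nonnegative, but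
  the same argument with vertices and cliques interchanged yields \<open>T\<^sup>2 \<ge> (\<surd>p - \<surd>q)\<^sup>2 T\<close> (\<open>T_gap\<close>), which
  leaves \<open>0\<close> as the only possible spectral value below the interval.

  All these points do occur.  The number of words of length \<open>n\<close> is of the order of \<open>(p q)\<^sup>n\<close>, and on
  radial functions \<open>T\<close> acts by a three-term recursion with solutions \<open>c\<^sup>n\<close> at the value \<open>(1 + q c) (p + 1 / c)\<close>.  Truncating
  them at a large length gives approximate eigenvectors when \<open>p q \<bar>c\<bar>\<^sup>2 = 1\<close>, because the norm of the
  function grows and that of the defect stays bounded; for \<open>c = - 1 / q\<close> and \<open>p < q\<close> the powers are
  square-summable and give an eigenvector at \<open>0\<close> (\<open>not_bounded_below_radial\<close>).
\<close>

section \<open>The Hilbert space of square-summable functions\<close>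

text \<open>
  The real part of the inner product, as a sum of inner products of the Euclidean plane.  It
  determines the norm, and it expresses adjoints over the complex scalars too, because
  multiplication by \<open>c\<close> has the adjoint multiplication by \<open>cnj c\<close>.
\<close>

definition ell2_inner :: "'x set \<Rightarrow> ('x \<Rightarrow> complex) \<Rightarrow> ('x \<Rightarrow> complex) \<Rightarrow> real" where
  "ell2_inner X f g = (\<Sum>\<^sub>\<infinity>x\<in>X. f x \<bullet> g x)"

lemma ell2_vanishes: "f \<in> ell2 X \<Longrightarrow> x \<notin> X \<Longrightarrow> f x = 0"
  by (simp add: ell2_def)

lemma ell2_summable: "f \<in> ell2 X \<Longrightarrow> (\<lambda>x. (cmod (f x))\<^sup>2) summable_on X"
  by (simp add: ell2_def)

lemma ell2_zero [simp]: "(\<lambda>x. 0) \<in> ell2 X"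
  by (simp add: ell2_def)

lemma ell2_scale:
  assumes "f \<in> ell2 X"
  shows "(\<lambda>x. c * f x) \<in> ell2 X"
  using assms summable_on_cmult_right[OF ell2_summable[OF assms], of "(cmod c)\<^sup>2"]
  by (auto simp: ell2_def norm_mult power_mult_distrib)

lemma inner_summable:
  assumes "f \<in> ell2 X" "g \<in> ell2 X"
  shows "(\<lambda>x. f x \<bullet> g x) summable_on X"
proof -
  have "(\<lambda>x. (cmod (f x))\<^sup>2 + (cmod (g x))\<^sup>2) summable_on X"
    by (intro summable_on_add ell2_summable assms)
  then have "(\<lambda>x. norm (f x \<bullet> g x)) summable_on X"
  proof (rule summable_on_comparison_test)
    fix x
    have "\<bar>f x \<bullet> g x\<bar> \<le> cmod (f x) * cmod (g x)"
      by (rule Cauchy_Schwarz_ineq2)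
    also have "\<dots> \<le> (cmod (f x))\<^sup>2 + (cmod (g x))\<^sup>2"
      using sum_squares_bound[of "cmod (f x)" "cmod (g x)"]
        mult_nonneg_nonneg[OF norm_ge_zero[of "f x"] norm_ge_zero[of "g x"]]
      by linarith
    finally show "norm (f x \<bullet> g x) \<le> (cmod (f x))\<^sup>2 + (cmod (g x))\<^sup>2" by simp
  qed auto
  then show ?thesis by (rule abs_summable_summable)
qed

lemma ell2_add:
  assumes "f \<in> ell2 X" "g \<in> ell2 X"
  shows "(\<lambda>x. f x + g x) \<in> ell2 X"
proof -
  have "(\<lambda>x. (cmod (f x))\<^sup>2 + (cmod (g x))\<^sup>2 + 2 * (f x \<bullet> g x)) summable_on X"
    by (intro summable_on_add summable_on_cmult_right ell2_summable inner_summable assms)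
  moreover have "(cmod (f x))\<^sup>2 + (cmod (g x))\<^sup>2 + 2 * (f x \<bullet> g x) = (cmod (f x + g x))\<^sup>2" for x
    unfolding power2_norm_eq_inner by (simp add: inner_simps inner_commute)
  ultimately show ?thesis
    using assms by (auto simp: ell2_def)
qed

lemma ell2_diff:
  assumes "f \<in> ell2 X" "g \<in> ell2 X"
  shows "(\<lambda>x. f x - g x) \<in> ell2 X"
  using ell2_add[OF assms(1) ell2_scale[OF assms(2), of "-1"]] by simp

lemma ell2_diff_scale:
  assumes "f \<in> ell2 X" "g \<in> ell2 X"
  shows "(\<lambda>x. f x - c * g x) \<in> ell2 X"
  using assms by (intro ell2_diff ell2_scale)

lemma ell2_sum:
  assumes "\<And>i. i \<in> I \<Longrightarrow> f i \<in> ell2 X"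
  shows "(\<lambda>x. \<Sum>i\<in>I. f i x) \<in> ell2 X"
  using assms by (induction I rule: infinite_finite_induct) (auto intro: ell2_add)

lemma ell2_finite_support:
  assumes "finite F" "F \<subseteq> X" "\<And>x. x \<notin> F \<Longrightarrow> f x = 0"
  shows "f \<in> ell2 X"
  and "(ell2_norm X f)\<^sup>2 = (\<Sum>x\<in>F. (cmod (f x))\<^sup>2)"
proof -
  have "((\<lambda>x. (cmod (f x))\<^sup>2) has_sum (\<Sum>x\<in>F. (cmod (f x))\<^sup>2)) X"
    using assms by (intro has_sum_finite_neutralI) auto
  then have *: "(\<lambda>x. (cmod (f x))\<^sup>2) summable_on X"
      "(\<Sum>\<^sub>\<infinity>x\<in>X. (cmod (f x))\<^sup>2) = (\<Sum>x\<in>F. (cmod (f x))\<^sup>2)"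
    by (simp_all add: has_sum_iff)
  show "f \<in> ell2 X"
    using * assms by (auto simp: ell2_def)
  show "(ell2_norm X f)\<^sup>2 = (\<Sum>x\<in>F. (cmod (f x))\<^sup>2)"
    by (simp add: ell2_norm_def * sum_nonneg)
qed

lemma ell2_inner_commute: "ell2_inner X f g = ell2_inner X g f"
  by (simp add: ell2_inner_def inner_commute)

lemma ell2_inner_add_left:
  assumes "f \<in> ell2 X" "g \<in> ell2 X" "h \<in> ell2 X"
  shows "ell2_inner X (\<lambda>x. f x + g x) h = ell2_inner X f h + ell2_inner X g h"
  using assms by (simp add: ell2_inner_def inner_add_left infsum_add inner_summable)

lemma ell2_inner_diff_left:
  assumes "f \<in> ell2 X" "g \<in> ell2 X" "h \<in> ell2 X"
  shows "ell2_inner X (\<lambda>x. f x - g x) h = ell2_inner X f h - ell2_inner X g h"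
  using ell2_inner_add_left[OF ell2_diff[OF assms(1,2)] assms(2,3)] by simp

lemma ell2_inner_sum_left:
  assumes "\<And>i. i \<in> I \<Longrightarrow> f i \<in> ell2 X" "g \<in> ell2 X"
  shows "ell2_inner X (\<lambda>x. \<Sum>i\<in>I. f i x) g = (\<Sum>i\<in>I. ell2_inner X (f i) g)"
  using assms
  by (induction I rule: infinite_finite_induct)
     (simp_all add: ell2_inner_add_left ell2_sum, simp_all add: ell2_inner_def)

lemma ell2_inner_scale_left:
  "ell2_inner X (\<lambda>x. c * f x) g = ell2_inner X f (\<lambda>x. cnj c * g x)"
  unfolding ell2_inner_def
  by (intro infsum_cong) (auto simp: inner_complex_def algebra_simps)

lemma ell2_inner_real_scale_left:
  "ell2_inner X (\<lambda>x. complex_of_real c * f x) g = c * ell2_inner X f g"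
  unfolding ell2_inner_def scaleR_conv_of_real[symmetric] by (simp add: infsum_cmult_right')

lemma ell2_norm_nonneg [simp]: "ell2_norm X f \<ge> 0"
  by (simp add: ell2_norm_def infsum_nonneg)

lemma ell2_norm_square: "(ell2_norm X f)\<^sup>2 = ell2_inner X f f"
  by (simp add: ell2_norm_def ell2_inner_def power2_norm_eq_inner[symmetric] infsum_nonneg)

lemma ell2_norm_scale: "ell2_norm X (\<lambda>x. c * f x) = cmod c * ell2_norm X f"
  by (simp add: ell2_norm_def norm_mult power_mult_distrib infsum_cmult_right' real_sqrt_mult)

lemma ell2_norm_square_add:
  assumes "f \<in> ell2 X" "g \<in> ell2 X"
  shows "(ell2_norm X (\<lambda>x. f x + g x))\<^sup>2
    = (ell2_norm X f)\<^sup>2 + 2 * ell2_inner X f g + (ell2_norm X g)\<^sup>2"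
proof -
  have "ell2_inner X h (\<lambda>x. f x + g x) = ell2_inner X f h + ell2_inner X g h" if "h \<in> ell2 X" for h
    using ell2_inner_add_left[OF assms that] ell2_inner_commute by metis
  then show ?thesis
    using ell2_inner_add_left[OF assms ell2_add[OF assms]] assms
    by (simp add: ell2_norm_square ell2_inner_commute[of X g f])
qed

lemma ell2_norm_square_diff:
  assumes "f \<in> ell2 X" "g \<in> ell2 X"
  shows "(ell2_norm X (\<lambda>x. f x - g x))\<^sup>2
    = (ell2_norm X f)\<^sup>2 - 2 * ell2_inner X f g + (ell2_norm X g)\<^sup>2"
  using ell2_norm_square_add[OF ell2_diff[OF assms] assms(2)]
    ell2_inner_diff_left[OF assms assms(2)] ell2_norm_square[of X g]
  by simp

lemma norm_le_ell2_norm: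
  assumes "f \<in> ell2 X" "x \<in> X"
  shows "cmod (f x) \<le> ell2_norm X f"
proof -
  have "(\<Sum>y\<in>{x}. (cmod (f y))\<^sup>2) \<le> (\<Sum>\<^sub>\<infinity>y\<in>X. (cmod (f y))\<^sup>2)"
    using assms by (intro finite_sum_le_infsum ell2_summable) auto
  then show ?thesis
    unfolding ell2_norm_def by (simp add: real_le_rsqrt)
qed

lemma ell2_Cauchy_Schwarz:
  assumes "f \<in> ell2 X" "g \<in> ell2 X"
  shows "ell2_inner X f g \<le> ell2_norm X f * ell2_norm X g"
  unfolding ell2_inner_def
proof (rule infsum_le_finite_sums[OF inner_summable[OF assms]])
  fix F assume F: "finite F" "F \<subseteq> X"
  have L2: "L2_set (\<lambda>x. cmod (h x)) F \<le> ell2_norm X h" if "h \<in> ell2 X" for h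
    unfolding L2_set_def ell2_norm_def
    using F ell2_summable[OF that] by (intro real_sqrt_le_mono finite_sum_le_infsum) auto
  have "(\<Sum>x\<in>F. f x \<bullet> g x) \<le> (\<Sum>x\<in>F. \<bar>cmod (f x)\<bar> * \<bar>cmod (g x)\<bar>)"
    by (intro sum_mono) (use norm_cauchy_schwarz in auto)
  also have "\<dots> \<le> L2_set (\<lambda>x. cmod (f x)) F * L2_set (\<lambda>x. cmod (g x)) F"
    by (rule L2_set_mult_ineq)
  also have "\<dots> \<le> ell2_norm X f * ell2_norm X g"
    using assms by (intro mult_mono L2) auto
  finally show "(\<Sum>x\<in>F. f x \<bullet> g x) \<le> ell2_norm X f * ell2_norm X g" .
qed

lemma ell2_norm_triangle:
  assumes "f \<in> ell2 X" "g \<in> ell2 X"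
  shows "ell2_norm X (\<lambda>x. f x + g x) \<le> ell2_norm X f + ell2_norm X g"
proof (rule power2_le_imp_le)
  show "(ell2_norm X (\<lambda>x. f x + g x))\<^sup>2 \<le> (ell2_norm X f + ell2_norm X g)\<^sup>2"
    using ell2_Cauchy_Schwarz[OF assms]
    by (simp add: ell2_norm_square_add[OF assms] power2_sum)
qed simp

lemma ell2_norm_sum:
  assumes "\<And>i. i \<in> I \<Longrightarrow> f i \<in> ell2 X"
  shows "ell2_norm X (\<lambda>x. \<Sum>i\<in>I. f i x) \<le> (\<Sum>i\<in>I. ell2_norm X (f i))"
  using assms
proof (induction I rule: infinite_finite_induct)
  case (insert i I)
  then have "ell2_norm X (\<lambda>x. f i x + (\<Sum>j\<in>I. f j x))
      \<le> ell2_norm X (f i) + ell2_norm X (\<lambda>x. \<Sum>j\<in>I. f j x)"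
    by (intro ell2_norm_triangle ell2_sum) auto
  with insert show ?case by simp
qed (simp_all add: ell2_norm_def)

lemma ell2_norm_eq_0:
  assumes "f \<in> ell2 X" "ell2_norm X f = 0"
  shows "f = (\<lambda>x. 0)"
proof
  fix x
  show "f x = 0"
    using norm_le_ell2_norm[OF assms(1), of x] assms ell2_vanishes[OF assms(1), of x] by fastforce
qed


section \<open>The spectrum of a symmetric operator\<close>

lemma bounded_operatorD:
  assumes "bounded_operator X T"
  shows "f \<in> ell2 X \<Longrightarrow> T f \<in> ell2 X"
    and "f \<in> ell2 X \<Longrightarrow> g \<in> ell2 X \<Longrightarrow> T (\<lambda>x. f x + g x) = (\<lambda>x. T f x + T g x)"
    and "f \<in> ell2 X \<Longrightarrow> T (\<lambda>x. c * f x) = (\<lambda>x. c * T f x)"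
  using assms by (auto simp: bounded_operator_def)

lemma bounded_operator_bound:
  assumes "bounded_operator X T"
  obtains K where "K > 0" "\<And>f. f \<in> ell2 X \<Longrightarrow> ell2_norm X (T f) \<le> K * ell2_norm X f"
proof -
  obtain K where K: "\<And>f. f \<in> ell2 X \<Longrightarrow> ell2_norm X (T f) \<le> K * ell2_norm X f"
    using assms unfolding bounded_operator_def by blast
  show ?thesis
  proof (rule that)
    show "\<bar>K\<bar> + 1 > 0" by simp
    fix f assume "f \<in> ell2 X"
    then have "ell2_norm X (T f) \<le> K * ell2_norm X f" by (rule K)
    also have "\<dots> \<le> (\<bar>K\<bar> + 1) * ell2_norm X f" by (intro mult_right_mono) auto
    finally show "ell2_norm X (T f) \<le> (\<bar>K\<bar> + 1) * ell2_norm X f" .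
  qed
qed

lemma bounded_operator_diff:
  assumes "bounded_operator X T" "f \<in> ell2 X" "g \<in> ell2 X"
  shows "T (\<lambda>x. f x - g x) = (\<lambda>x. T f x - T g x)"
proof -
  have "T (\<lambda>x. f x + (-1) * g x) = (\<lambda>x. T f x + (-1) * T g x)"
    using assms ell2_scale[OF assms(3), of "-1"]
    by (simp only: bounded_operatorD[OF assms(1)] ell2_scale)
  then show ?thesis by simp
qed

lemma bounded_operator_shift:
  assumes T: "bounded_operator X T"
  shows "bounded_operator X (\<lambda>f x. T f x - z * f x)"
proof -
  obtain K where K: "\<And>f. f \<in> ell2 X \<Longrightarrow> ell2_norm X (T f) \<le> K * ell2_norm X f"
    using bounded_operator_bound[OF T] by metis
  have "ell2_norm X (\<lambda>x. T f x - z * f x) \<le> (K + cmod z) * ell2_norm X f" if "f \<in> ell2 X" for f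
    using ell2_norm_triangle[OF bounded_operatorD(1)[OF T that] ell2_scale[OF that, of "-z"]]
      K[OF that] ell2_norm_scale[of X "-z" f]
    by (simp add: algebra_simps)
  then show ?thesis
    unfolding bounded_operator_def
    using bounded_operatorD[OF T]
    by (intro conjI ballI allI exI[of _ "K + cmod z"])
       (auto simp: algebra_simps intro!: ell2_diff ell2_scale)
qed

definition bounded_below :: "'x set \<Rightarrow> (('x \<Rightarrow> complex) \<Rightarrow> ('x \<Rightarrow> complex)) \<Rightarrow> bool" where
  "bounded_below X T \<longleftrightarrow> (\<exists>c>0. \<forall>f\<in>ell2 X. c * ell2_norm X f \<le> ell2_norm X (T f))"

lemma bounded_belowI:
  assumes "c > 0" "\<And>f. f \<in> ell2 X \<Longrightarrow> c * ell2_norm X f \<le> ell2_norm X (T f)"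
  shows "bounded_below X T"
  using assms unfolding bounded_below_def by auto

lemma bounded_belowE:
  assumes "bounded_below X T"
  obtains c where "c > 0" "\<And>f. f \<in> ell2 X \<Longrightarrow> c * ell2_norm X f \<le> ell2_norm X (T f)"
  using assms unfolding bounded_below_def by auto

text \<open>
  The solution is the Neumann series \<open>\<Sum>k. T\<^sup>k g\<close>, summed pointwise: a value is bounded by the norm, so
  each coordinate is a geometrically convergent series.
\<close>

lemma neumann_series_surj:
  assumes maps: "\<And>f. f \<in> ell2 X \<Longrightarrow> T f \<in> ell2 X"
    and add: "\<And>f g. f \<in> ell2 X \<Longrightarrow> g \<in> ell2 X \<Longrightarrow> T (\<lambda>x. f x + g x) = (\<lambda>x. T f x + T g x)"
    and contr: "\<And>f. f \<in> ell2 X \<Longrightarrow> ell2_norm X (T f) \<le> \<theta> * ell2_norm X f"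
    and \<theta>: "0 \<le> \<theta>" "\<theta> < 1"
    and g: "g \<in> ell2 X"
  shows "\<exists>f\<in>ell2 X. (\<lambda>x. f x - T f x) = g"
proof -
  define s where "s h x = (\<Sum>k. (T ^^ k) h x)" for h x
  have pow: "(T ^^ k) h \<in> ell2 X" "ell2_norm X ((T ^^ k) h) \<le> \<theta> ^ k * ell2_norm X h"
    if "h \<in> ell2 X" for h k
  proof (induction k)
    case (Suc k)
    { case 1 then show ?case using Suc maps by simp }
    { case 2
      have "ell2_norm X ((T ^^ Suc k) h) \<le> \<theta> * ell2_norm X ((T ^^ k) h)"
        using contr Suc by simp
      also have "\<dots> \<le> \<theta> * (\<theta> ^ k * ell2_norm X h)"
        using Suc \<theta> by (intro mult_left_mono) auto
      finally show ?case by simp }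
  qed (use that in simp_all)
  have summ: "summable (\<lambda>k. (T ^^ k) h x)" if h: "h \<in> ell2 X" for h x
  proof (rule summable_comparison_test')
    show "summable (\<lambda>k. \<theta> ^ k * ell2_norm X h)"
      using \<theta> by (intro summable_mult2 summable_geometric) auto
    fix k :: nat
    show "norm ((T ^^ k) h x) \<le> \<theta> ^ k * ell2_norm X h"
    proof (cases "x \<in> X")
      case True
      then show ?thesis using norm_le_ell2_norm[OF pow(1)[OF h, of k] True] pow(2)[OF h, of k] by simp
    next
      case False
      then show ?thesis using ell2_vanishes[OF pow(1)[OF h, of k] False] \<theta> by simp
    qed
  qed
  \<comment> \<open>The geometric bound on the norms of the partial sums passes to the pointwise limit because it
    can be tested on finite sets of coordinates.\<close>
  have s: "s h \<in> ell2 X" "ell2_norm X (s h) \<le> ell2_norm X h / (1 - \<theta>)" if h: "h \<in> ell2 X" for h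
  proof -
    let ?B = "ell2_norm X h / (1 - \<theta>)"
    have B: "0 \<le> ?B" using \<theta> by simp
    have part: "ell2_norm X (\<lambda>x. \<Sum>k<n. (T ^^ k) h x) \<le> ?B" for n
    proof -
      have "ell2_norm X (\<lambda>x. \<Sum>k<n. (T ^^ k) h x) \<le> (\<Sum>k<n. ell2_norm X ((T ^^ k) h))"
        using pow(1)[OF h] by (intro ell2_norm_sum)
      also have "\<dots> \<le> (\<Sum>k<n. \<theta> ^ k * ell2_norm X h)"
        using pow(2)[OF h] by (intro sum_mono)
      also have "\<dots> \<le> (\<Sum>k. \<theta> ^ k * ell2_norm X h)"
        using \<theta> by (intro sum_le_suminf summable_mult2 summable_geometric) auto
      also have "\<dots> = ?B"
        using \<theta> by (simp add: suminf_mult2[symmetric] summable_geometric suminf_geometric)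
      finally show ?thesis .
    qed
    have fin: "(\<Sum>x\<in>F. (cmod (s h x))\<^sup>2) \<le> ?B\<^sup>2" if F: "finite F" "F \<subseteq> X" for F
    proof (rule LIMSEQ_le_const2)
      show "(\<lambda>n. \<Sum>x\<in>F. (cmod (\<Sum>k<n. (T ^^ k) h x))\<^sup>2) \<longlonglongrightarrow> (\<Sum>x\<in>F. (cmod (s h x))\<^sup>2)"
        unfolding s_def by (intro tendsto_intros summable_LIMSEQ summ h)
      have "(\<Sum>x\<in>F. (cmod (\<Sum>k<n. (T ^^ k) h x))\<^sup>2) \<le> ?B\<^sup>2" for n
      proof -
        have "(\<Sum>x\<in>F. (cmod (\<Sum>k<n. (T ^^ k) h x))\<^sup>2)
            \<le> (\<Sum>\<^sub>\<infinity>x\<in>X. (cmod (\<Sum>k<n. (T ^^ k) h x))\<^sup>2)"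
          using F ell2_summable[OF ell2_sum[OF pow(1)[OF h]]] by (intro finite_sum_le_infsum) auto
        also have "\<dots> = (ell2_norm X (\<lambda>x. \<Sum>k<n. (T ^^ k) h x))\<^sup>2"
          by (simp add: ell2_norm_def infsum_nonneg)
        also have "\<dots> \<le> ?B\<^sup>2"
          using part by (intro power_mono) auto
        finally show ?thesis .
      qed
      then show "\<exists>N. \<forall>n\<ge>N. (\<Sum>x\<in>F. (cmod (\<Sum>k<n. (T ^^ k) h x))\<^sup>2) \<le> ?B\<^sup>2" by blast
    qed
    have sm: "(\<lambda>x. (cmod (s h x))\<^sup>2) summable_on X"
      using fin by (intro nonneg_bdd_above_summable_on bdd_aboveI2[of _ _ "?B\<^sup>2"]) auto
    have "s h x = 0" if "x \<notin> X" for x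
      unfolding s_def using ell2_vanishes[OF pow(1)[OF h] that] by simp
    then show "s h \<in> ell2 X" using sm by (simp add: ell2_def)
    have "(ell2_norm X (s h))\<^sup>2 \<le> ?B\<^sup>2"
      using infsum_le_finite_sums[OF sm fin] by (simp add: ell2_norm_def infsum_nonneg)
    then show "ell2_norm X (s h) \<le> ?B" using B by (rule power2_le_imp_le)
  qed
  define f where "f = s g"
  have zero: "T (\<lambda>x. 0) = (\<lambda>x. 0)"
    using add[OF ell2_zero ell2_zero] by (auto simp: fun_eq_iff)
  have Tsum: "T (\<lambda>x. \<Sum>k<n. (T ^^ k) g x) = (\<lambda>x. \<Sum>k<n. (T ^^ Suc k) g x)" for n
    by (induction n) (simp_all add: zero add[OF ell2_sum[OF pow(1)[OF g]] pow(1)[OF g]])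
  \<comment> \<open>\<open>T\<close> shifts the partial sums by one term, and it maps the remainder \<open>s (T\<^sup>n g)\<close> to a function
    of norm at most \<open>\<theta>\<^sup>n\<^sup>+\<^sup>1 ell2_norm X g / (1 - \<theta>)\<close>.\<close>
  have "T f x = f x - g x" for x
  proof (cases "x \<in> X")
    case True
    let ?e = "\<lambda>n. T f x - ((\<Sum>k<Suc n. (T ^^ k) g x) - g x)"
    have split: "f = (\<lambda>x. (\<Sum>k<n. (T ^^ k) g x) + s ((T ^^ n) g) x)" for n
    proof
      fix x
      show "f x = (\<Sum>k<n. (T ^^ k) g x) + s ((T ^^ n) g) x"
        unfolding f_def s_def using suminf_split_initial_segment[OF summ[OF g], of x n]
        by (simp add: funpow_add algebra_simps)
    qed
    have e: "?e n = T (s ((T ^^ n) g)) x" for n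
    proof -
      have "T f = (\<lambda>x. (\<Sum>k<n. (T ^^ Suc k) g x) + T (s ((T ^^ n) g)) x)"
        by (subst split[of n]) (simp only: add[OF ell2_sum[OF pow(1)[OF g]] s(1)[OF pow(1)[OF g]]] Tsum)
      then show ?thesis
        using sum.lessThan_Suc_shift[of "\<lambda>k. (T ^^ k) g x" n] by simp
    qed
    have "?e \<longlonglongrightarrow> 0"
    proof (rule Lim_null_comparison)
      show "(\<lambda>n. \<theta> * ((\<theta> ^ n * ell2_norm X g) / (1 - \<theta>))) \<longlonglongrightarrow> 0"
        using \<theta> by (auto intro!: tendsto_eq_intros LIMSEQ_realpow_zero)
      show "\<forall>\<^sub>F n in sequentially. norm (?e n) \<le> \<theta> * ((\<theta> ^ n * ell2_norm X g) / (1 - \<theta>))"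
      proof (intro always_eventually allI)
        fix n
        have "norm (?e n) \<le> ell2_norm X (T (s ((T ^^ n) g)))"
          unfolding e using True by (intro norm_le_ell2_norm maps s pow g)
        also have "\<dots> \<le> \<theta> * ell2_norm X (s ((T ^^ n) g))"
          by (intro contr s pow g)
        also have "\<dots> \<le> \<theta> * (ell2_norm X ((T ^^ n) g) / (1 - \<theta>))"
          using \<theta> by (intro mult_left_mono s pow g) auto
        also have "\<dots> \<le> \<theta> * ((\<theta> ^ n * ell2_norm X g) / (1 - \<theta>))"
          using \<theta> by (intro mult_left_mono divide_right_mono pow g) auto
        finally show "norm (?e n) \<le> \<theta> * ((\<theta> ^ n * ell2_norm X g) / (1 - \<theta>))" .
      qed
    qed
    moreover have "?e \<longlonglongrightarrow> T f x - (f x - g x)"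
      unfolding f_def s_def
      by (intro tendsto_intros LIMSEQ_Suc[OF summable_LIMSEQ[OF summ[OF g]]])
    ultimately show ?thesis using LIMSEQ_unique by fastforce
  next
    case False
    have "f \<in> ell2 X" unfolding f_def by (intro s g)
    then have "T f \<in> ell2 X" by (rule maps)
    with \<open>f \<in> ell2 X\<close> show ?thesis by (simp add: ell2_vanishes[OF _ False] g)
  qed
  then have "(\<lambda>x. f x - T f x) = g" by auto
  moreover have "f \<in> ell2 X" unfolding f_def by (rule s(1)[OF g])
  ultimately show ?thesis by (rule bexI)
qed

text \<open>
  A lower bound makes \<open>T - z\<close> injective and bounds every right inverse; injectivity then forces the
  right inverse to be linear and two-sided.
\<close>

lemma not_in_spectrum_iff_bijective:
  assumes T: "bounded_operator X T"
  shows "z \<notin> operator_spectrum X T \<longleftrightarrow>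
    bounded_below X (\<lambda>f x. T f x - z * f x) \<and>
    (\<forall>g\<in>ell2 X. \<exists>f\<in>ell2 X. (\<lambda>x. T f x - z * f x) = g)"
    (is "_ \<longleftrightarrow> ?below \<and> ?surj")
proof
  define D where "D = (\<lambda>f x. T f x - z * f x)"
  have D: "bounded_operator X D"
    unfolding D_def by (rule bounded_operator_shift[OF T])
  show "?below \<and> ?surj" if "z \<notin> operator_spectrum X T"
  proof -
    have "\<exists>R. bounded_operator X R \<and> (\<forall>f\<in>ell2 X. R (D f) = f) \<and> (\<forall>f\<in>ell2 X. D (R f) = f)"
      using that unfolding operator_spectrum_def D_def by simp
    then obtain R where R: "bounded_operator X R"
      "\<And>f. f \<in> ell2 X \<Longrightarrow> R (D f) = f" "\<And>f. f \<in> ell2 X \<Longrightarrow> D (R f) = f"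
      by metis
    obtain K where K: "K > 0" "\<And>f. f \<in> ell2 X \<Longrightarrow> ell2_norm X (R f) \<le> K * ell2_norm X f"
      using bounded_operator_bound[OF R(1)] by metis
    have "inverse K * ell2_norm X f \<le> ell2_norm X (D f)" if "f \<in> ell2 X" for f
      using K(2)[OF bounded_operatorD(1)[OF D that]] R(2)[OF that] K(1)
      by (simp add: field_simps)
    moreover have "inverse K > 0" using K(1) by simp
    ultimately have "bounded_below X D"
      by (rule bounded_belowI[rotated])
    moreover have "\<exists>f\<in>ell2 X. D f = g" if "g \<in> ell2 X" for g
      using R(3)[OF that] bounded_operatorD(1)[OF R(1) that] by (rule bexI)
    ultimately show ?thesis unfolding D_def by simp
  qed
  show "z \<notin> operator_spectrum X T" if "?below \<and> ?surj"
  proof -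
    have below: "bounded_below X D" using that by (simp add: D_def)
    obtain c where c: "c > 0" "\<And>f. f \<in> ell2 X \<Longrightarrow> c * ell2_norm X f \<le> ell2_norm X (D f)"
      using bounded_belowE[OF below] by metis
    have inj: "f = g" if "f \<in> ell2 X" "g \<in> ell2 X" "D f = D g" for f g
    proof -
      have "c * ell2_norm X (\<lambda>x. f x - g x) \<le> ell2_norm X (\<lambda>x. 0)"
        using c(2)[OF ell2_diff[OF that(1,2)]] bounded_operator_diff[OF D that(1,2)] that(3)
        by simp
      then have "ell2_norm X (\<lambda>x. f x - g x) = 0"
        using c(1) by (simp add: ell2_norm_def[of X "\<lambda>x. 0"] mult_le_0_iff antisym)
      from ell2_norm_eq_0[OF ell2_diff[OF that(1,2)] this] show ?thesis
        by (simp add: fun_eq_iff)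
    qed
    have "\<forall>g\<in>ell2 X. \<exists>f. f \<in> ell2 X \<and> D f = g"
      using that unfolding D_def by (simp add: Bex_def)
    then obtain R where R: "\<And>g. g \<in> ell2 X \<Longrightarrow> R g \<in> ell2 X" "\<And>g. g \<in> ell2 X \<Longrightarrow> D (R g) = g"
      by metis
    have bound: "ell2_norm X (R g) \<le> inverse c * ell2_norm X g" if "g \<in> ell2 X" for g
      using c(2)[OF R(1)[OF that]] R(2)[OF that] c(1) by (simp add: field_simps)
    have "bounded_operator X R"
      unfolding bounded_operator_def
    proof (intro conjI ballI allI exI[of _ "inverse c"])
      fix f g assume fg: "f \<in> ell2 X" "g \<in> ell2 X"
      show "R (\<lambda>x. f x + g x) = (\<lambda>x. R f x + R g x)"
        by (rule inj[rotated 2])  (simp_all add: R fg ell2_add bounded_operatorD(2)[OF D])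
    next
      fix a f assume f: "f \<in> ell2 X"
      show "R (\<lambda>x. a * f x) = (\<lambda>x. a * R f x)"
        by (rule inj[rotated 2]) (simp_all add: R f ell2_scale bounded_operatorD(3)[OF D])
    qed (use R bound in auto)
    moreover have "R (D f) = f" if "f \<in> ell2 X" for f
      by (rule inj[rotated 2]) (simp_all add: R that bounded_operatorD(1)[OF D])
    ultimately show ?thesis
      using R(2) unfolding operator_spectrum_def D_def by auto
  qed
qed

definition symmetric_operator :: "'x set \<Rightarrow> (('x \<Rightarrow> complex) \<Rightarrow> ('x \<Rightarrow> complex)) \<Rightarrow> bool" where
  "symmetric_operator X T \<longleftrightarrow>
     (\<forall>f\<in>ell2 X. \<forall>g\<in>ell2 X. ell2_inner X (T f) g = ell2_inner X f (T g))"

lemma symmetric_shift_adjoint: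
  assumes T: "bounded_operator X T" "symmetric_operator X T" and f: "f \<in> ell2 X" and g: "g \<in> ell2 X"
  shows "ell2_inner X (\<lambda>x. T f x - z * f x) g = ell2_inner X f (\<lambda>x. T g x - cnj z * g x)"
proof -
  have "ell2_inner X (\<lambda>x. T f x - z * f x) g = ell2_inner X (T f) g - ell2_inner X (\<lambda>x. z * f x) g"
    by (rule ell2_inner_diff_left[OF bounded_operatorD(1)[OF T(1) f] ell2_scale[OF f] g])
  also have "\<dots> = ell2_inner X (T g) f - ell2_inner X (\<lambda>x. cnj z * g x) f"
    using T(2) f g ell2_inner_commute[of X f] ell2_inner_scale_left[of X z f g]
    by (simp add: symmetric_operator_def)
  also have "\<dots> = ell2_inner X (\<lambda>x. T g x - cnj z * g x) f"
    by (rule ell2_inner_diff_left[symmetric, OF bounded_operatorD(1)[OF T(1) g] ell2_scale[OF g] f])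
  finally show ?thesis by (simp add: ell2_inner_commute)
qed

text \<open>
  For \<open>H = T - z\<close> the adjoint is \<open>H* = T - cnj z\<close>, and it commutes with \<open>H\<close>.  If \<open>H\<close> is bounded below by
  \<open>c\<close> and \<open>H*\<close> has norm at most \<open>K\<close>, then
  \<open>\<parallel>f - e H* H f\<parallel>\<^sup>2 \<le> \<parallel>f\<parallel>\<^sup>2 - 2 e \<parallel>H f\<parallel>\<^sup>2 + e\<^sup>2 K\<^sup>2 \<parallel>H f\<parallel>\<^sup>2\<close>, so for \<open>e = 1 / K\<^sup>2\<close> the operator
  \<open>1 - e H* H\<close> is a strict contraction.  Hence \<open>e H* H = H (e H*)\<close> is onto, and so is \<open>H\<close>.
\<close>

theorem symmetric_spectrum:
  assumes T: "bounded_operator X T" "symmetric_operator X T"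
  shows "z \<in> operator_spectrum X T \<longleftrightarrow> \<not> bounded_below X (\<lambda>f x. T f x - z * f x)"
proof (rule ccontr)
  define H where "H w = (\<lambda>f x. T f x - w * f x)" for w
  have H_apply: "H w f = (\<lambda>x. T f x - w * f x)" for w f by (simp add: H_def)
  have H: "bounded_operator X (H w)" for w
    unfolding H_def by (rule bounded_operator_shift[OF T(1)])
  note HD = bounded_operatorD[OF H]
  have adj: "ell2_inner X (H w f) g = ell2_inner X f (H (cnj w) g)"
    if "f \<in> ell2 X" "g \<in> ell2 X" for w f g
    using symmetric_shift_adjoint[OF T that, of w] unfolding H_def .
  assume "\<not> ?thesis"
  then have below: "bounded_below X (H z)" and not_surj: "\<not> (\<forall>g\<in>ell2 X. \<exists>f\<in>ell2 X. H z f = g)"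
    using not_in_spectrum_iff_bijective[OF T(1), of z] by (auto simp: H_def)
  obtain c where c: "c > 0" "\<And>f. f \<in> ell2 X \<Longrightarrow> c * ell2_norm X f \<le> ell2_norm X (H z f)"
    using bounded_belowE[OF below] by metis
  obtain K0 where K0: "K0 > 0"
      "\<And>f. f \<in> ell2 X \<Longrightarrow> ell2_norm X (H (cnj z) f) \<le> K0 * ell2_norm X f"
    using bounded_operator_bound[OF H] by metis
  \<comment> \<open>With \<open>K \<ge> c\<close> the contraction factor below is the square root of a nonnegative number.\<close>
  define K where "K = max K0 c"
  have K: "K > 0" "K \<ge> c" "\<And>f. f \<in> ell2 X \<Longrightarrow> ell2_norm X (H (cnj z) f) \<le> K * ell2_norm X f"
  proof -
    show "K > 0" "K \<ge> c" using c by (auto simp: K_def)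
    show "ell2_norm X (H (cnj z) f) \<le> K * ell2_norm X f" if "f \<in> ell2 X" for f
      using K0(2)[OF that] mult_right_mono[of K0 K "ell2_norm X f"] by (simp add: K_def)
  qed
  define e where "e = inverse (K\<^sup>2)"
  have e: "e > 0" "e * K\<^sup>2 = 1" using K by (simp_all add: e_def)
  define C where "C f = (\<lambda>x. f x - e * H (cnj z) (H z f) x)" for f
  define \<theta> where "\<theta> = sqrt (1 - e * c\<^sup>2)"
  have ec: "0 < e * c\<^sup>2" "e * c\<^sup>2 \<le> 1"
    using e c K mult_left_mono[OF power_mono[OF K(2), of 2], of e] by auto
  have "\<exists>f\<in>ell2 X. (\<lambda>x. f x - C f x) = g" if "g \<in> ell2 X" for g
  proof (rule neumann_series_surj[where \<theta> = \<theta>])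
    show "C f \<in> ell2 X" if "f \<in> ell2 X" for f
      unfolding C_def using that by (intro ell2_diff_scale HD)
    show "C (\<lambda>x. f x + g x) = (\<lambda>x. C f x + C g x)" if "f \<in> ell2 X" "g \<in> ell2 X" for f g
      unfolding C_def using that by (simp add: HD algebra_simps)
    show "0 \<le> \<theta>" "\<theta> < 1" unfolding \<theta>_def using ec by auto
    show "ell2_norm X (C f) \<le> \<theta> * ell2_norm X f" if f: "f \<in> ell2 X" for f
    proof (rule power2_le_imp_le)
      let ?g = "H (cnj z) (H z f)"
      have g: "?g \<in> ell2 X" using f by (intro HD)
      have "(ell2_norm X (C f))\<^sup>2 = (ell2_norm X f)\<^sup>2
          - 2 * ell2_inner X f (\<lambda>x. e * ?g x) + (ell2_norm X (\<lambda>x. e * ?g x))\<^sup>2"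
        unfolding C_def by (intro ell2_norm_square_diff f ell2_scale g)
      also have "ell2_inner X f (\<lambda>x. e * ?g x) = e * ell2_inner X (H z f) (H z f)"
        using adj[OF f HD(1)[OF f], of z z]
        by (subst ell2_inner_commute) (simp add: ell2_inner_real_scale_left ell2_inner_commute)
      also have "(ell2_norm X (\<lambda>x. e * ?g x))\<^sup>2 = e\<^sup>2 * (ell2_norm X ?g)\<^sup>2"
        by (simp add: ell2_norm_scale power_mult_distrib)
      also have "\<dots> \<le> e\<^sup>2 * (K * ell2_norm X (H z f))\<^sup>2"
        using f by (intro mult_left_mono power_mono K HD) auto
      also have "\<dots> = e * (ell2_norm X (H z f))\<^sup>2"
      proof -
        have "e\<^sup>2 * (K * a)\<^sup>2 = e * (e * K\<^sup>2) * a\<^sup>2" for a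
          by (simp add: power2_eq_square algebra_simps)
        then show ?thesis unfolding e(2) by simp
      qed
      finally have "(ell2_norm X (C f))\<^sup>2 \<le> (ell2_norm X f)\<^sup>2 - e * (ell2_norm X (H z f))\<^sup>2"
        by (simp add: ell2_norm_square)
      also have "\<dots> \<le> (ell2_norm X f)\<^sup>2 - e * (c * ell2_norm X f)\<^sup>2"
        using e c f by (intro diff_left_mono mult_left_mono power_mono) auto
      also have "\<dots> = (\<theta> * ell2_norm X f)\<^sup>2"
        using ec by (simp add: \<theta>_def power_mult_distrib algebra_simps)
      finally show "(ell2_norm X (C f))\<^sup>2 \<le> (\<theta> * ell2_norm X f)\<^sup>2" .
      show "0 \<le> \<theta> * ell2_norm X f" unfolding \<theta>_def using ec by simp
    qed
  qed fact
  moreover have "H z (H (cnj z) f) = H (cnj z) (H z f)" if f: "f \<in> ell2 X" for f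
  proof -
    have TH: "T (H w f) = (\<lambda>x. T (T f) x - w * T f x)" for w
      unfolding H_def using f bounded_operatorD[OF T(1)]
      by (subst bounded_operator_diff[OF T(1)]) (auto intro: ell2_scale)
    show ?thesis
      unfolding H_apply[of z "H (cnj z) f"] H_apply[of "cnj z" "H z f"] TH
      by (simp add: H_apply algebra_simps)
  qed
  ultimately have "\<exists>f\<in>ell2 X. H z (\<lambda>x. e * H (cnj z) f x) = g" if "g \<in> ell2 X" for g
    using that unfolding C_def by (fastforce simp: HD)
  then show False
    using not_surj ell2_scale HD(1) by metis
qed

section \<open>Cosets of the factors\<close>

definition ends_in :: "'i \<Rightarrow> ('i \<times> 'a) list \<Rightarrow> bool" where
  "ends_in i w \<longleftrightarrow> w \<noteq> [] \<and> fst (last w) = i"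

text \<open>
  The shortest word in the coset \<open>w G\<^sub>i\<close>, the vertex at which the clique \<open>w G\<^sub>i\<close> hangs.
\<close>

definition stem :: "'i \<Rightarrow> ('i \<times> 'a) list \<Rightarrow> ('i \<times> 'a) list" where
  "stem i w = (if ends_in i w then butlast w else w)"

lemma ends_in_simps [simp]: "\<not> ends_in i []" "ends_in i (w @ [(j, g)]) \<longleftrightarrow> j = i"
  by (auto simp: ends_in_def)

lemma reduced_words_snoc:
  "w @ [(i, g)] \<in> reduced_words I G \<longleftrightarrow>
     w \<in> reduced_words I G \<and> i \<in> I \<and> g \<in> carrier (G i) \<and> g \<noteq> \<one>\<^bsub>G i\<^esub> \<and> \<not> ends_in i w"
  by (auto simp: reduced_words_def ends_in_def distinct_adj_append_iff last_map)

lemma foldr_syllable_mult_append: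
  assumes "u @ v \<in> reduced_words I G"
  shows "foldr (syllable_mult G) u v = u @ v"
  using assms
proof (induction u)
  case (Cons s u)
  obtain i x where s: "s = (i, x)" by (cases s)
  have "syllable_mult G (i, x) w = (i, x) # w" if "(i, x) # w \<in> reduced_words I G" for w
    using that by (cases w) (auto simp: reduced_words_Cons)
  with Cons s show ?case by (simp add: reduced_words_Cons)
qed simp

lemma has_sum_sum:
  fixes F :: "'k \<Rightarrow> 'x \<Rightarrow> real"
  assumes "\<And>k. k \<in> K \<Longrightarrow> (F k has_sum s k) Y"
  shows "((\<lambda>x. \<Sum>k\<in>K. F k x) has_sum (\<Sum>k\<in>K. s k)) Y"
  using assms by (induction K rule: infinite_finite_induct) (auto intro!: has_sum_add)

lemma norm_sum_square_le:
  fixes b :: "'k \<Rightarrow> complex"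
  shows "(cmod (\<Sum>j\<in>J. b j))\<^sup>2 \<le> real (card J) * (\<Sum>j\<in>J. (cmod (b j))\<^sup>2)"
proof -
  have "(cmod (\<Sum>j\<in>J. b j))\<^sup>2 \<le> (\<Sum>j\<in>J. cmod (b j))\<^sup>2"
    by (intro power_mono norm_sum) auto
  also have "\<dots> \<le> real (card J) * (\<Sum>j\<in>J. (cmod (b j))\<^sup>2)"
    using sum_squared_le_sum_of_squares[of "\<lambda>j. cmod (b j)" J] by (simp add: mult.commute)
  finally show ?thesis .
qed

text \<open>
  The constants \<open>p = r - 1\<close> and \<open>q = L - 1\<close> below are the branching numbers: every word other than the
  empty one is the stem of \<open>p\<close> cosets, and every coset has \<open>q\<close> elements besides its stem.
\<close>

locale equal_free_product =
  fixes I :: "'i set" and r L :: nat and G :: "'i \<Rightarrow> ('a, 'b) monoid_scheme"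
  assumes r: "r \<ge> 2" "card I = r" and L: "L \<ge> 2"
    and grp: "\<And>i. i \<in> I \<Longrightarrow> group (G i)"
    and fin: "\<And>i. i \<in> I \<Longrightarrow> finite (carrier (G i))"
    and ord: "\<And>i. i \<in> I \<Longrightarrow> order (G i) = L"
begin

abbreviation "X \<equiv> reduced_words I G"
abbreviation "A \<equiv> free_product I G"
abbreviation "S \<equiv> free_product_generators I G"
abbreviation "p \<equiv> real r - 1"
abbreviation "q \<equiv> real L - 1"
abbreviation "nontriv i \<equiv> carrier (G i) - {\<one>\<^bsub>G i\<^esub>}"
abbreviation "emb \<equiv> free_product_inj G"

lemma finite_I [simp]: "finite I"
  using r by (intro card_ge_0_finite) simp

lemma pq: "p \<ge> 1" "q \<ge> 1"
  using r L by simp_all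

lemma carrier_A [simp]: "carrier A = X"
  by (simp add: free_product_def)

lemma one_closed_factor: "i \<in> I \<Longrightarrow> \<one>\<^bsub>G i\<^esub> \<in> carrier (G i)"
  using grp[of i] by (simp add: group.is_monoid monoid.one_closed)

lemma card_factor: "i \<in> I \<Longrightarrow> card (carrier (G i)) = L"
  using ord by (simp add: order_def)

lemma nontriv: "i \<in> I \<Longrightarrow> finite (nontriv i)" "i \<in> I \<Longrightarrow> card (nontriv i) = L - 1"
  using fin one_closed_factor by (auto simp: card_factor)

lemma real_card_nontriv: "i \<in> I \<Longrightarrow> real (card (nontriv i)) = q"
  using nontriv L by (simp add: of_nat_diff)

lemma emb_closed: "i \<in> I \<Longrightarrow> g \<in> carrier (G i) \<Longrightarrow> emb i g \<in> X"
  by (simp add: free_product_inj_def reduced_words_Cons)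

sublocale A: group A
  by (rule free_product_group) (rule grp)

lemma emb_mult:
  assumes "i \<in> I" "g \<in> carrier (G i)" "h \<in> carrier (G i)"
  shows "emb i g \<otimes>\<^bsub>A\<^esub> emb i h = emb i (g \<otimes>\<^bsub>G i\<^esub> h)"
  using hom_mult[OF free_product_inj_hom[of I G, OF grp assms(1)] assms(2,3)] by simp

lemma mult_emb_closed: "x \<in> X \<Longrightarrow> i \<in> I \<Longrightarrow> g \<in> carrier (G i) \<Longrightarrow> x \<otimes>\<^bsub>A\<^esub> emb i g \<in> X"
  using A.m_closed[of x "emb i g"] emb_closed by simp

lemma mult_emb_append:
  assumes "x \<in> X" "i \<in> I" "g \<in> carrier (G i)" "\<not> ends_in i x"
  shows "x \<otimes>\<^bsub>A\<^esub> emb i g = (if g = \<one>\<^bsub>G i\<^esub> then x else x @ [(i, g)])"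
proof (cases "g = \<one>\<^bsub>G i\<^esub>")
  case True
  then show ?thesis
    using A.r_one[of x] assms(1) by (simp add: free_product_inj_def free_product_def)
next
  case False
  then show ?thesis
    using assms foldr_syllable_mult_append[of x "[(i, g)]" I G] reduced_words_snoc[of x i g I G]
    by (simp add: free_product_inj_def free_product_def)
qed

definition coset_sum :: "'i \<Rightarrow> (('i \<times> 'a) list \<Rightarrow> 'c) \<Rightarrow> ('i \<times> 'a) list \<Rightarrow> 'c::comm_monoid_add"
  where "coset_sum i F x = (\<Sum>g\<in>carrier (G i). F (x \<otimes>\<^bsub>A\<^esub> emb i g))"

lemma coset_sum_shift:
  assumes x: "x \<in> X" and i: "i \<in> I" and h: "h \<in> carrier (G i)"
  shows "coset_sum i F (x \<otimes>\<^bsub>A\<^esub> emb i h) = coset_sum i F x"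
proof -
  interpret Gi: group "G i" using grp i .
  have bij: "bij_betw (\<lambda>g. h \<otimes>\<^bsub>G i\<^esub> g) (carrier (G i)) (carrier (G i))"
    using Gi.inj_on_cmult[OF h] Gi.surj_const_mult[OF h] by (simp add: bij_betw_def)
  have "coset_sum i F (x \<otimes>\<^bsub>A\<^esub> emb i h) = (\<Sum>g\<in>carrier (G i). F (x \<otimes>\<^bsub>A\<^esub> emb i (h \<otimes>\<^bsub>G i\<^esub> g)))"
    unfolding coset_sum_def
    using x i h by (intro sum.cong refl) (simp add: A.m_assoc emb_closed emb_mult)
  also have "\<dots> = coset_sum i F x"
    unfolding coset_sum_def by (rule sum.reindex_bij_betw[OF bij])
  finally show ?thesis .
qed

lemma stem_cases:
  assumes "x \<in> X" "i \<in> I"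
  obtains h where "h \<in> carrier (G i)" "x = stem i x \<otimes>\<^bsub>A\<^esub> emb i h" "stem i x \<in> X"
    "\<not> ends_in i (stem i x)"
proof (cases "ends_in i x")
  case True
  then obtain u h where x: "x = u @ [(i, h)]"
    by (cases x rule: rev_cases) (auto simp: ends_in_def)
  then have u: "u \<in> X" "h \<in> carrier (G i)" "h \<noteq> \<one>\<^bsub>G i\<^esub>" "\<not> ends_in i u"
    using assms(1) by (simp_all add: reduced_words_snoc)
  have "stem i x = u" using x by (simp add: stem_def)
  then show ?thesis
    using that[of h] u x mult_emb_append[OF u(1) assms(2) u(2,4)] by simp
next
  case False
  then show ?thesis
    using that[OF one_closed_factor[OF assms(2)]] assms
      mult_emb_append[OF assms one_closed_factor[OF assms(2)]]
    by (simp add: stem_def)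
qed

lemma stem_closed: "x \<in> X \<Longrightarrow> i \<in> I \<Longrightarrow> stem i x \<in> X"
  and stem_not_ends_in: "x \<in> X \<Longrightarrow> i \<in> I \<Longrightarrow> \<not> ends_in i (stem i x)"
  using stem_cases by metis+

text \<open>
  The coset \<open>x G\<^sub>i\<close> consists of its stem and of the words that extend the stem by one syllable from
  \<open>G\<^sub>i\<close>.  So words and cosets form a rooted tree, along which the estimates below are made.
\<close>

lemma coset_sum_stem:
  assumes x: "x \<in> X" and i: "i \<in> I"
  shows "coset_sum i F x = F (stem i x) + (\<Sum>g\<in>nontriv i. F (stem i x @ [(i, g)]))"
proof -
  let ?u = "stem i x"
  obtain h where h: "h \<in> carrier (G i)" "x = ?u \<otimes>\<^bsub>A\<^esub> emb i h" and u: "?u \<in> X" "\<not> ends_in i ?u"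
    using stem_cases[OF x i] by metis
  have "coset_sum i F x = coset_sum i F ?u"
    using coset_sum_shift[OF u(1) i h(1)] h(2) by metis
  also have "\<dots> = F (?u \<otimes>\<^bsub>A\<^esub> emb i \<one>\<^bsub>G i\<^esub>) + (\<Sum>g\<in>nontriv i. F (?u \<otimes>\<^bsub>A\<^esub> emb i g))"
    unfolding coset_sum_def by (rule sum.remove[OF fin[OF i] one_closed_factor[OF i]])
  also have "\<dots> = F ?u + (\<Sum>g\<in>nontriv i. F (?u @ [(i, g)]))"
    using mult_emb_append[OF u(1) i _ u(2)] one_closed_factor[OF i]
    by (intro arg_cong2[of _ _ _ _ "(+)"] sum.cong) auto
  finally show ?thesis .
qed

text \<open>
  Summing over \<open>x\<close> first, each of the \<open>L\<close> right translations preserves the total.  This replaces sums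
  over cosets by sums over words.
\<close>

lemma coset_sum_mass:
  fixes F :: "('i \<times> 'a) list \<Rightarrow> real"
  assumes i: "i \<in> I" and F: "F summable_on X"
  shows "coset_sum i F summable_on X"
    and "(\<Sum>\<^sub>\<infinity>x\<in>X. coset_sum i F x) = real L * (\<Sum>\<^sub>\<infinity>x\<in>X. F x)"
proof -
  have bij: "bij_betw (\<lambda>x. x \<otimes>\<^bsub>A\<^esub> emb i g) X X" if "g \<in> carrier (G i)" for g
  proof (rule bij_betwI[where g = "\<lambda>x. x \<otimes>\<^bsub>A\<^esub> inv\<^bsub>A\<^esub> emb i g"])
    show "(\<lambda>x. x \<otimes>\<^bsub>A\<^esub> emb i g) \<in> X \<rightarrow> X" "(\<lambda>x. x \<otimes>\<^bsub>A\<^esub> inv\<^bsub>A\<^esub> emb i g) \<in> X \<rightarrow> X"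
      using A.m_closed A.inv_closed emb_closed[OF i that] by auto
    show "x \<otimes>\<^bsub>A\<^esub> emb i g \<otimes>\<^bsub>A\<^esub> inv\<^bsub>A\<^esub> emb i g = x" "x \<otimes>\<^bsub>A\<^esub> inv\<^bsub>A\<^esub> emb i g \<otimes>\<^bsub>A\<^esub> emb i g = x"
      if "x \<in> X" for x
      using that emb_closed[OF i \<open>g \<in> carrier (G i)\<close>] A.inv_closed[of "emb i g"]
      by (simp_all add: A.m_assoc)
  qed
  have summ: "(\<lambda>x. F (x \<otimes>\<^bsub>A\<^esub> emb i g)) summable_on X" if "g \<in> carrier (G i)" for g
    using summable_on_reindex_bij_betw[OF bij[OF that], of F] F by simp
  have "coset_sum i F = (\<lambda>x. \<Sum>g\<in>carrier (G i). F (x \<otimes>\<^bsub>A\<^esub> emb i g))"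
    by (simp add: coset_sum_def fun_eq_iff)
  moreover have "((\<lambda>x. \<Sum>g\<in>carrier (G i). F (x \<otimes>\<^bsub>A\<^esub> emb i g)) has_sum
      (\<Sum>g\<in>carrier (G i). \<Sum>\<^sub>\<infinity>x\<in>X. F x)) X"
  proof (rule has_sum_sum)
    fix g assume g: "g \<in> carrier (G i)"
    show "((\<lambda>x. F (x \<otimes>\<^bsub>A\<^esub> emb i g)) has_sum (\<Sum>\<^sub>\<infinity>x\<in>X. F x)) X"
      using summ[OF g] infsum_reindex_bij_betw[OF bij[OF g], of F] by (simp add: has_sum_iff)
  qed
  ultimately show "coset_sum i F summable_on X"
      "(\<Sum>\<^sub>\<infinity>x\<in>X. coset_sum i F x) = real L * (\<Sum>\<^sub>\<infinity>x\<in>X. F x)"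
    using card_factor[OF i] by (simp_all add: has_sum_iff)
qed


section \<open>The coset operators\<close>

text \<open>
  \<open>P i / L\<close> is the orthogonal projection onto the functions that are constant on the cosets of \<open>G\<^sub>i\<close>, and
  \<open>T = \<Sum>i. P i\<close> is the adjacency operator of the Cayley graph plus \<open>r\<close>.
\<close>

definition P :: "'i \<Rightarrow> (('i \<times> 'a) list \<Rightarrow> complex) \<Rightarrow> ('i \<times> 'a) list \<Rightarrow> complex" where
  "P i f = (\<lambda>x. if x \<in> X then coset_sum i f x else 0)"

definition T :: "(('i \<times> 'a) list \<Rightarrow> complex) \<Rightarrow> ('i \<times> 'a) list \<Rightarrow> complex" where
  "T f = (\<lambda>x. \<Sum>i\<in>I. P i f x)"

lemma P_bounded:
  assumes i: "i \<in> I" and f: "f \<in> ell2 X"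
  shows "P i f \<in> ell2 X" and "ell2_norm X (P i f) \<le> real L * ell2_norm X f"
proof -
  let ?F = "\<lambda>x. (cmod (f x))\<^sup>2"
  note mass = coset_sum_mass[OF i ell2_summable[OF f]]
  have le: "(cmod (P i f x))\<^sup>2 \<le> real L * coset_sum i ?F x" if "x \<in> X" for x
    using norm_sum_square_le[of "\<lambda>g. f (x \<otimes>\<^bsub>A\<^esub> emb i g)" "carrier (G i)"] that
    by (simp add: P_def coset_sum_def card_factor[OF i])
  have summ: "(\<lambda>x. (cmod (P i f x))\<^sup>2) summable_on X"
    by (rule summable_on_comparison_test[OF summable_on_cmult_right[OF mass(1), of "real L"]])
       (use le in auto)
  then show P: "P i f \<in> ell2 X"
    by (auto simp: ell2_def P_def)
  have "(\<Sum>\<^sub>\<infinity>x\<in>X. (cmod (P i f x))\<^sup>2) \<le> (\<Sum>\<^sub>\<infinity>x\<in>X. real L * coset_sum i ?F x)"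
    by (intro infsum_mono summ summable_on_cmult_right mass le)
  also have "\<dots> = real L * (real L * (\<Sum>\<^sub>\<infinity>x\<in>X. ?F x))"
    by (simp add: infsum_cmult_right' mass)
  also have "\<dots> = (real L * ell2_norm X f)\<^sup>2"
    by (simp add: ell2_norm_def power_mult_distrib infsum_nonneg power2_eq_square)
  finally have "(ell2_norm X (P i f))\<^sup>2 \<le> (real L * ell2_norm X f)\<^sup>2"
    by (simp add: ell2_norm_def infsum_nonneg)
  then show "ell2_norm X (P i f) \<le> real L * ell2_norm X f"
    by (rule power2_le_imp_le) simp
qed

text \<open>
  \<open>P i f\<close> is constant on cosets, so averaging the pairing over each coset changes nothing but the
  factor \<open>L\<close>.
\<close>

lemma P_inner:
  assumes i: "i \<in> I" and f: "f \<in> ell2 X" and g: "g \<in> ell2 X"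
  shows "ell2_inner X (P i f) (P i g) = real L * ell2_inner X (P i f) g"
proof -
  have "ell2_inner X (P i f) (P i g) = (\<Sum>\<^sub>\<infinity>x\<in>X. coset_sum i (\<lambda>y. P i f y \<bullet> g y) x)"
    unfolding ell2_inner_def
  proof (rule infsum_cong)
    fix x assume x: "x \<in> X"
    have "P i f (x \<otimes>\<^bsub>A\<^esub> emb i h) = P i f x" if "h \<in> carrier (G i)" for h
      using x i that coset_sum_shift[OF x i that, of f] by (simp add: P_def mult_emb_closed)
    then have "coset_sum i (\<lambda>y. P i f y \<bullet> g y) x = P i f x \<bullet> coset_sum i g x"
      by (simp add: coset_sum_def inner_sum_right)
    then show "P i f x \<bullet> P i g x = coset_sum i (\<lambda>y. P i f y \<bullet> g y) x"
      using x by (simp add: P_def[of i g])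
  qed
  also have "\<dots> = real L * ell2_inner X (P i f) g"
    unfolding ell2_inner_def by (intro coset_sum_mass i inner_summable P_bounded f g)
  finally show ?thesis .
qed

lemma P_symmetric:
  assumes "i \<in> I" "f \<in> ell2 X" "g \<in> ell2 X"
  shows "ell2_inner X (P i f) g = ell2_inner X f (P i g)"
proof -
  have "real L * ell2_inner X (P i f) g = real L * ell2_inner X (P i g) f"
    using P_inner[OF assms] P_inner[OF assms(1,3,2)] ell2_inner_commute by metis
  then show ?thesis using L by (simp add: ell2_inner_commute)
qed

lemma P_add: "P i (\<lambda>x. f x + g x) = (\<lambda>x. P i f x + P i g x)"
  and P_scale: "P i (\<lambda>x. c * f x) = (\<lambda>x. c * P i f x)"
  by (auto simp: P_def coset_sum_def fun_eq_iff sum.distrib sum_distrib_left)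

lemma T_bounded: "bounded_operator X T"
proof -
  have "ell2_norm X (T f) \<le> (\<Sum>i\<in>I. real L) * ell2_norm X f" if "f \<in> ell2 X" for f
  proof -
    have "ell2_norm X (T f) \<le> (\<Sum>i\<in>I. ell2_norm X (P i f))"
      unfolding T_def by (intro ell2_norm_sum P_bounded that)
    also have "\<dots> \<le> (\<Sum>i\<in>I. real L * ell2_norm X f)"
      by (intro sum_mono P_bounded that)
    finally show ?thesis by (simp only: sum_distrib_right)
  qed
  then show ?thesis
    unfolding bounded_operator_def
    by (intro conjI ballI allI exI[of _ "\<Sum>i\<in>I. real L"])
       (auto simp: T_def P_add P_scale sum.distrib sum_distrib_left intro!: ell2_sum P_bounded)
qed

lemma T_inner:
  assumes "f \<in> ell2 X" "g \<in> ell2 X"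
  shows "ell2_inner X (T f) g = (\<Sum>i\<in>I. ell2_inner X (P i f) g)"
  unfolding T_def using assms by (intro ell2_inner_sum_left P_bounded)

lemma T_symmetric: "symmetric_operator X T"
  unfolding symmetric_operator_def
proof (intro ballI)
  fix f g assume fg: "f \<in> ell2 X" "g \<in> ell2 X"
  have "ell2_inner X (T f) g = (\<Sum>i\<in>I. ell2_inner X (P i g) f)"
    unfolding T_inner[OF fg]
    using P_symmetric[OF _ fg] ell2_inner_commute[of X f] by (intro sum.cong refl) simp
  also have "\<dots> = ell2_inner X f (T g)"
    using T_inner[OF fg(2,1)] by (simp add: ell2_inner_commute)
  finally show "ell2_inner X (T f) g = ell2_inner X f (T g)" .
qed

lemma P_inner_self:
  assumes "i \<in> I" "f \<in> ell2 X"
  shows "real L * ell2_inner X (P i f) f = (ell2_norm X (P i f))\<^sup>2"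
  using P_inner[OF assms assms(2)] by (simp add: ell2_norm_square)

lemma T_nonneg:
  assumes "f \<in> ell2 X"
  shows "ell2_inner X (T f) f \<ge> 0"
proof -
  have "ell2_inner X (P i f) f \<ge> 0" if "i \<in> I" for i
  proof -
    have "0 \<le> real L * ell2_inner X (P i f) f"
      unfolding P_inner_self[OF that assms] by simp
    then show ?thesis using L by (simp add: zero_le_mult_iff)
  qed
  then show ?thesis unfolding T_inner[OF assms assms] by (rule sum_nonneg)
qed

end

section \<open>Quadratic form estimates\<close>

text \<open>
  Young's inequality \<open>2 \<bar>a \<bullet> b\<bar> \<le> t \<bar>a\<bar>\<^sup>2 + \<bar>b\<bar>\<^sup>2 / t\<close>.  The sign \<open>\<sigma> = \<plusminus>1\<close> makes it serve for upper as
  well as for lower bounds.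
\<close>

lemma weighted_square:
  fixes a b :: complex and \<sigma> t :: real
  assumes t: "t > 0" and \<sigma>: "\<sigma> * \<sigma> = 1"
  shows "\<sigma> * (cmod (a + b))\<^sup>2 \<le> (\<sigma> + t) * (cmod a)\<^sup>2 + (\<sigma> + 1 / t) * (cmod b)\<^sup>2"
proof -
  have "0 \<le> (norm (t *\<^sub>R a - \<sigma> *\<^sub>R b))\<^sup>2 / t" using t by simp
  also have "(norm (t *\<^sub>R a - \<sigma> *\<^sub>R b))\<^sup>2 = t * t * (a \<bullet> a) - 2 * t * \<sigma> * (a \<bullet> b) + \<sigma> * \<sigma> * (b \<bullet> b)"
    unfolding power2_norm_eq_inner by (simp add: inner_simps inner_commute algebra_simps)
  also have "\<dots> / t = t * (a \<bullet> a) - 2 * \<sigma> * (a \<bullet> b) + (b \<bullet> b) / t"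
    using t by (simp add: \<sigma> field_simps)
  finally show ?thesis
    unfolding power2_norm_eq_inner by (simp add: inner_simps inner_commute algebra_simps)
qed

lemma weighted_square_sum:
  fixes a :: complex and b :: "'k \<Rightarrow> complex"
  assumes "t > 0" "\<sigma> * \<sigma> = 1" "\<sigma> + 1 / t \<ge> 0"
  shows "\<sigma> * (cmod (a + (\<Sum>j\<in>J. b j)))\<^sup>2
    \<le> (\<sigma> + t) * (cmod a)\<^sup>2 + (\<Sum>j\<in>J. (\<sigma> + 1 / t) * real (card J) * (cmod (b j))\<^sup>2)"
  using weighted_square[OF assms(1,2), of a "\<Sum>j\<in>J. b j"]
    mult_left_mono[OF norm_sum_square_le[of b J] assms(3)]
  by (simp add: sum_distrib_left[symmetric] mult.assoc)

lemma summable_on_weighted: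
  fixes h w :: "'x \<Rightarrow> real"
  assumes h: "h summable_on Y" and nonneg: "\<And>y. h y \<ge> 0" and w: "\<And>y. \<bar>w y\<bar> \<le> B"
  shows "(\<lambda>y. w y * h y) summable_on Y"
proof (rule abs_summable_summable)
  show "(\<lambda>y. norm (w y * h y)) summable_on Y"
    by (rule summable_on_comparison_test[OF summable_on_cmult_right[OF h, of B]])
       (use mult_right_mono[OF w nonneg] nonneg in \<open>auto simp: abs_mult\<close>)
qed

lemma sqrt_quotient:
  fixes a b :: real
  assumes "a > 0" "b > 0"
  shows "a * sqrt (b / a) = sqrt (a * b)" and "b * (1 / sqrt (b / a)) = sqrt (a * b)"
proof -
  have *: "x * sqrt (y / x) = sqrt (x * y)" if "x > 0" for x y :: real
    using real_sqrt_mult[of "x * x" "y / x"] that by simp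
  show "a * sqrt (b / a) = sqrt (a * b)" by (rule *[OF assms(1)])
  show "b * (1 / sqrt (b / a)) = sqrt (a * b)"
    using *[OF assms(2), of a] by (simp add: real_sqrt_divide mult.commute)
qed

text \<open>
  The choice \<open>t = \<surd>(q / p)\<close> balances \<open>p t\<close> against \<open>q / t\<close>: both become \<open>\<surd>(p q)\<close>.
\<close>

lemma upper_weights:
  fixes p q :: real
  assumes "p \<ge> 1" "q \<ge> 1"
  defines "t \<equiv> sqrt (q / p)"
  shows "t > 0" "(p + 1) * (1 + t) \<le> p + q + 2 * sqrt (p * q)"
    "p * (1 + t) + (1 + 1 / t) * q \<le> p + q + 2 * sqrt (p * q)"
proof -
  show t: "t > 0" using assms by simp
  have s: "p * t = sqrt (p * q)" "q * (1 / t) = sqrt (p * q)"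
    using sqrt_quotient[of p q] assms by simp_all
  have "q / p \<le> q * 1" using assms by (simp add: divide_le_eq)
  also have "\<dots> \<le> q * p" using assms by (intro mult_left_mono) auto
  finally have "t \<le> sqrt (p * q)" unfolding t_def by (simp add: mult.commute)
  then have "p + p * t + 1 + t \<le> p + q + 2 * sqrt (p * q)" using s assms by linarith
  then show "(p + 1) * (1 + t) \<le> p + q + 2 * sqrt (p * q)" by (simp add: algebra_simps)
  have "p + p * t + q + q * (1 / t) \<le> p + q + 2 * sqrt (p * q)" using s by linarith
  then show "p * (1 + t) + (1 + 1 / t) * q \<le> p + q + 2 * sqrt (p * q)" by (simp add: algebra_simps)
qed

lemma lower_weights:
  fixes p q :: real
  assumes "p \<ge> 1" "q \<ge> 1" "q \<le> p"
  defines "t \<equiv> sqrt (q / p)"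
  shows "t > 0" "-1 + 1 / t \<ge> 0" "(p + 1) * (-1 + t) \<le> - (p + q - 2 * sqrt (p * q))"
    "p * (-1 + t) + (-1 + 1 / t) * q \<le> - (p + q - 2 * sqrt (p * q))"
proof -
  show t: "t > 0" using assms by simp
  have t1: "t \<le> 1" using assms by simp
  show t2: "-1 + 1 / t \<ge> 0" using t t1 by simp
  have s: "p * t = sqrt (p * q)" "q * (1 / t) = sqrt (p * q)"
    using sqrt_quotient[of p q] assms by simp_all
  have "0 \<le> q * (-1 + 1 / t)" using t2 assms by (intro mult_nonneg_nonneg) auto
  then have "q \<le> q * (1 / t)" by (simp add: algebra_simps)
  then have "- p + p * t - 1 + t \<le> - (p + q - 2 * sqrt (p * q))" using s t1 by linarith
  then show "(p + 1) * (-1 + t) \<le> - (p + q - 2 * sqrt (p * q))" by (simp add: algebra_simps)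
  have "- p + p * t - q + q * (1 / t) \<le> - (p + q - 2 * sqrt (p * q))" using s by linarith
  then show "p * (-1 + t) + (-1 + 1 / t) * q \<le> - (p + q - 2 * sqrt (p * q))" by (simp add: algebra_simps)
qed

context equal_free_product
begin

lemma ends_in_last:
  assumes "x \<in> X" "x \<noteq> []"
  obtains j where "j \<in> I" "\<And>i. ends_in i x \<longleftrightarrow> i = j"
proof -
  have "last x \<in> set x" using assms by simp
  then have "fst (last x) \<in> I"
    using assms by (auto simp: reduced_words_def case_prod_unfold)
  then show ?thesis using that[of "fst (last x)"] assms by (auto simp: ends_in_def)
qed

lemma sum_ends_in:
  fixes a b :: "'c::real_vector"
  assumes "x \<in> X"
  shows "(\<Sum>i\<in>I. if ends_in i x then b else a) = (if x = [] then (p + 1) *\<^sub>R a else p *\<^sub>R a + b)"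
proof (cases "x = []")
  case True
  then show ?thesis using r by (simp add: sum_constant_scaleR)
next
  case False
  obtain j where j: "j \<in> I" "\<And>i. ends_in i x \<longleftrightarrow> i = j"
    using ends_in_last[OF assms False] by metis
  have "(\<Sum>i\<in>I. if ends_in i x then b else a) = b + (\<Sum>i\<in>I - {j}. a)"
    using j by (simp add: sum.remove[OF finite_I j(1)])
  then show ?thesis using False j r by (simp add: of_nat_diff sum_constant_scaleR)
qed

text \<open>
  Young's inequality between the stem and the sum of the \<open>q\<close> other elements, whose square is at most
  \<open>q\<close> times the sum of the squares.  Written as a coset sum of weighted values, the bound can be
  summed over all words.
\<close>

lemma coset_sum_weighted:
  assumes t: "t > 0" "\<sigma> * \<sigma> = 1" "\<sigma> + 1 / t \<ge> 0" and x: "x \<in> X" and i: "i \<in> I"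
  shows "\<sigma> * (cmod (coset_sum i f x))\<^sup>2
    \<le> coset_sum i (\<lambda>y. (if ends_in i y then (\<sigma> + 1 / t) * q else \<sigma> + t) * (cmod (f y))\<^sup>2) x"
  unfolding coset_sum_stem[OF x i]
  using weighted_square_sum[OF t, of "f (stem i x)" "\<lambda>g. f (stem i x @ [(i, g)])" "nontriv i"]
    stem_not_ends_in[OF x i] real_card_nontriv[OF i]
  by simp

text \<open>
  The form \<open>\<langle>P i f, f\<rangle>\<close> is \<open>1 / L\<close> times the sum of \<open>\<bar>P i f x\<bar>\<^sup>2\<close>.  After weighting, each word collects
  the stem weight \<open>\<sigma> + t\<close> from the \<open>p\<close> factors in which it does not end and the weight
  \<open>(\<sigma> + 1 / t) q\<close> from the one in which it does; the empty word is a stem for all \<open>p + 1\<close> factors.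
\<close>

lemma T_form_bound:
  assumes t: "t > 0" "\<sigma> * \<sigma> = 1" "\<sigma> + 1 / t \<ge> 0"
    and C: "(p + 1) * (\<sigma> + t) \<le> C" "p * (\<sigma> + t) + (\<sigma> + 1 / t) * q \<le> C"
    and f: "f \<in> ell2 X"
  shows "\<sigma> * ell2_inner X (T f) f \<le> C * (ell2_norm X f)\<^sup>2"
proof -
  define w where "w i y = (if ends_in i y then (\<sigma> + 1 / t) * q else \<sigma> + t)"
    for i and y :: "('i \<times> 'a) list"
  let ?h = "\<lambda>i y. w i y * (cmod (f y))\<^sup>2"
  have summ: "?h i summable_on X" for i
    by (rule summable_on_weighted[OF ell2_summable[OF f],
          where B = "max \<bar>(\<sigma> + 1 / t) * q\<bar> \<bar>\<sigma> + t\<bar>"]) (auto simp: w_def)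
  have P: "\<sigma> * ell2_inner X (P i f) f \<le> (\<Sum>\<^sub>\<infinity>y\<in>X. ?h i y)" if i: "i \<in> I" for i
  proof -
    have "real L * (\<sigma> * ell2_inner X (P i f) f) = \<sigma> * (ell2_norm X (P i f))\<^sup>2"
      by (simp add: P_inner_self[OF i f, symmetric])
    also have "\<dots> = (\<Sum>\<^sub>\<infinity>x\<in>X. \<sigma> * (cmod (P i f x))\<^sup>2)"
      by (simp add: ell2_norm_def infsum_nonneg infsum_cmult_right')
    also have "\<dots> \<le> (\<Sum>\<^sub>\<infinity>x\<in>X. coset_sum i (?h i) x)"
    proof (rule infsum_mono)
      show "(\<lambda>x. \<sigma> * (cmod (P i f x))\<^sup>2) summable_on X"
        by (intro summable_on_cmult_right ell2_summable P_bounded i f)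
      show "coset_sum i (?h i) summable_on X"
        by (rule coset_sum_mass[OF i summ])
      show "\<sigma> * (cmod (P i f x))\<^sup>2 \<le> coset_sum i (?h i) x" if "x \<in> X" for x
        using coset_sum_weighted[OF t that i, of f] that by (simp add: P_def w_def)
    qed
    also have "\<dots> = real L * (\<Sum>\<^sub>\<infinity>y\<in>X. ?h i y)"
      by (rule coset_sum_mass[OF i summ])
    finally show ?thesis using L by simp
  qed
  have sum: "((\<lambda>y. \<Sum>i\<in>I. ?h i y) has_sum (\<Sum>i\<in>I. \<Sum>\<^sub>\<infinity>y\<in>X. ?h i y)) X"
    using summ by (intro has_sum_sum) simp
  have "\<sigma> * ell2_inner X (T f) f = (\<Sum>i\<in>I. \<sigma> * ell2_inner X (P i f) f)"
    by (simp add: T_inner[OF f f] sum_distrib_left)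
  also have "\<dots> \<le> (\<Sum>i\<in>I. \<Sum>\<^sub>\<infinity>y\<in>X. ?h i y)"
    by (intro sum_mono P)
  also have "\<dots> = (\<Sum>\<^sub>\<infinity>y\<in>X. \<Sum>i\<in>I. ?h i y)"
    using sum by (simp add: has_sum_iff)
  also have "\<dots> \<le> (\<Sum>\<^sub>\<infinity>y\<in>X. C * (cmod (f y))\<^sup>2)"
  proof (rule infsum_mono)
    show "(\<lambda>y. \<Sum>i\<in>I. ?h i y) summable_on X" using sum by (simp add: has_sum_iff)
    show "(\<lambda>y. C * (cmod (f y))\<^sup>2) summable_on X"
      by (intro summable_on_cmult_right ell2_summable f)
    fix y assume "y \<in> X"
    then have "(\<Sum>i\<in>I. w i y) \<le> C"
      unfolding w_def sum_ends_in[OF \<open>y \<in> X\<close>] using C by simp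
    then show "(\<Sum>i\<in>I. ?h i y) \<le> C * (cmod (f y))\<^sup>2"
      by (simp add: sum_distrib_right[symmetric] mult_right_mono)
  qed
  also have "\<dots> = C * (ell2_norm X f)\<^sup>2"
    by (simp add: ell2_norm_def infsum_nonneg infsum_cmult_right')
  finally show ?thesis .
qed

lemma T_upper:
  assumes f: "f \<in> ell2 X"
  shows "ell2_inner X (T f) f \<le> (p + q + 2 * sqrt (p * q)) * (ell2_norm X f)\<^sup>2"
  using T_form_bound[OF _ _ _ upper_weights(2,3)[OF pq] f] upper_weights(1)[OF pq] by simp

lemma T_lower:
  assumes f: "f \<in> ell2 X" and "q \<le> p"
  shows "ell2_inner X (T f) f \<ge> (p + q - 2 * sqrt (p * q)) * (ell2_norm X f)\<^sup>2"
proof -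
  have "-1 * ell2_inner X (T f) f \<le> - (p + q - 2 * sqrt (p * q)) * (ell2_norm X f)\<^sup>2"
    using lower_weights[OF pq assms(2)] by (intro T_form_bound[where t = "sqrt (q / p)"] f) auto
  then show ?thesis by (simp only: mult_minus_left mult_1_left neg_le_iff_le)
qed

text \<open>
  This is the lower bound \<open>\<parallel>\<Sum>i. u\<^sub>i\<parallel>\<^sup>2 \<ge> (\<surd>q - \<surd>p)\<^sup>2 / L * \<Sum>i. \<parallel>u\<^sub>i\<parallel>\<^sup>2\<close> for \<open>u\<^sub>i = P i f\<close>.  Each \<open>u\<^sub>i\<close> is
  constant on the cosets of \<open>G\<^sub>i\<close>, hence is a function on cosets, and the roles of words and cosets are
  exchanged: a word lies in one coset of which it is not the stem, and in \<open>p\<close> cosets that hang at it.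
  So the weights of Young's inequality are taken with \<open>p\<close> and \<open>q\<close> interchanged.
\<close>

lemma T_gap:
  assumes f: "f \<in> ell2 X" and "p < q"
  shows "(p + q - 2 * sqrt (p * q)) * ell2_inner X (T f) f \<le> (ell2_norm X (T f))\<^sup>2"
proof -
  let ?c = "p + q - 2 * sqrt (p * q)"
  define t where "t = sqrt (p / q)"
  have t: "t > 0" "t < 1" using pq assms(2) by (simp_all add: t_def)
  have s: "q * t = sqrt (p * q)" "p * (1 / t) = sqrt (p * q)"
    using sqrt_quotient[of q p] pq by (simp_all add: t_def mult.commute)
  have t1: "-1 + 1 / t \<ge> 0" using t by simp
  define v where "v i y = (if ends_in i y then -1 + t else (-1 + 1 / t) * p)"
    for i and y :: "('i \<times> 'a) list"
  let ?h = "\<lambda>i y. v i y * (cmod (P i f y))\<^sup>2"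
  \<comment> \<open>A nonempty word ends in exactly one factor \<open>j\<close>, which supplies the distinguished summand; at the
    empty word all weights are nonnegative.\<close>
  have pointwise: "- 1 * (cmod (T f x))\<^sup>2 \<le> (\<Sum>i\<in>I. ?h i x)" if x: "x \<in> X" for x
  proof (cases "x = []")
    case True
    then have "0 \<le> (\<Sum>i\<in>I. ?h i x)"
      using t1 pq by (intro sum_nonneg) (auto simp: v_def)
    then show ?thesis by (smt (verit) zero_le_power2)
  next
    case False
    then obtain j where j: "j \<in> I" "\<And>i. ends_in i x \<longleftrightarrow> i = j"
      using ends_in_last[OF x] by metis
    have "T f x = P j f x + (\<Sum>i\<in>I - {j}. P i f x)"
      by (simp add: T_def sum.remove[OF finite_I j(1)])
    moreover have "real (card (I - {j})) = p" using r j by (simp add: of_nat_diff)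
    moreover have "(\<Sum>i\<in>I. ?h i x) = (-1 + t) * (cmod (P j f x))\<^sup>2
        + (\<Sum>i\<in>I - {j}. (-1 + 1 / t) * p * (cmod (P i f x))\<^sup>2)"
      using j by (simp add: sum.remove[OF finite_I j(1)] v_def)
    ultimately show ?thesis
      using weighted_square_sum[OF t(1) _ t1, of "P j f x" "\<lambda>i. P i f x" "I - {j}"] by simp
  qed
  have mass: "?h i summable_on X" "(\<Sum>\<^sub>\<infinity>x\<in>X. ?h i x) = - ?c * ell2_inner X (P i f) f"
    if i: "i \<in> I" for i
  proof -
    show summ: "?h i summable_on X"
      by (rule summable_on_weighted[OF ell2_summable[OF P_bounded(1)[OF i f]],
            where B = "max \<bar>(-1 + 1 / t) * p\<bar> \<bar>-1 + t\<bar>"]) (auto simp: v_def)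
    have "coset_sum i (?h i) x = - ?c * (cmod (P i f x))\<^sup>2" if x: "x \<in> X" for x
    proof -
      have inv: "P i f (x \<otimes>\<^bsub>A\<^esub> emb i g) = P i f x" if "g \<in> carrier (G i)" for g
        using x i that coset_sum_shift[OF x i that, of f] by (simp add: P_def mult_emb_closed)
      have "coset_sum i (?h i) x = coset_sum i (v i) x * (cmod (P i f x))\<^sup>2"
        by (simp add: coset_sum_def inv sum_distrib_right)
      also have "coset_sum i (v i) x = - ?c"
      proof -
        have "coset_sum i (v i) x = (-1 + 1 / t) * p + q * (-1 + t)"
          unfolding coset_sum_stem[OF x i] using stem_not_ends_in[OF x i]
          by (simp add: v_def real_card_nontriv[OF i])
        also have "\<dots> = p * (1 / t) + q * t - p - q" by (simp add: algebra_simps)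
        finally show ?thesis unfolding s by simp
      qed
      finally show ?thesis .
    qed
    then have "real L * (\<Sum>\<^sub>\<infinity>x\<in>X. ?h i x) = (\<Sum>\<^sub>\<infinity>x\<in>X. - ?c * (cmod (P i f x))\<^sup>2)"
      unfolding coset_sum_mass(2)[OF i summ, symmetric] by (intro infsum_cong)
    also have "\<dots> = - ?c * (ell2_norm X (P i f))\<^sup>2"
      unfolding infsum_cmult_right' by (simp add: ell2_norm_def infsum_nonneg)
    also have "\<dots> = real L * (- ?c * ell2_inner X (P i f) f)"
      by (simp add: P_inner_self[OF i f, symmetric])
    finally show "(\<Sum>\<^sub>\<infinity>x\<in>X. ?h i x) = - ?c * ell2_inner X (P i f) f"
      using L by simp
  qed
  have sum: "((\<lambda>x. \<Sum>i\<in>I. ?h i x) has_sum (\<Sum>i\<in>I. \<Sum>\<^sub>\<infinity>x\<in>X. ?h i x)) X"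
    using mass(1) by (intro has_sum_sum) simp
  have "- 1 * (ell2_norm X (T f))\<^sup>2 = (\<Sum>\<^sub>\<infinity>x\<in>X. - 1 * (cmod (T f x))\<^sup>2)"
    unfolding infsum_cmult_right' by (simp add: ell2_norm_def infsum_nonneg)
  also have "\<dots> \<le> (\<Sum>\<^sub>\<infinity>x\<in>X. \<Sum>i\<in>I. ?h i x)"
    using sum pointwise f
    by (intro infsum_mono summable_on_cmult_right ell2_summable bounded_operatorD(1)[OF T_bounded])
       (simp_all add: has_sum_iff)
  also have "\<dots> = (\<Sum>i\<in>I. - ?c * ell2_inner X (P i f) f)"
    using sum mass(2) by (simp add: has_sum_iff)
  also have "\<dots> = - ?c * ell2_inner X (T f) f"
    unfolding T_inner[OF f f] by (rule sum_distrib_left[symmetric])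
  finally show ?thesis by (simp add: algebra_simps)
qed

end


section \<open>Lower bounds away from the spectrum\<close>

text \<open>
  By the Cauchy-Schwarz inequality, a form bounded away from zero after rotation by a unit \<open>c\<close> gives a
  lower bound on the norm.
\<close>

lemma bounded_below_by_form:
  assumes T: "bounded_operator X T" and d: "d > 0" and c: "cmod c = 1"
    and form: "\<And>f. f \<in> ell2 X \<Longrightarrow>
      d * (ell2_norm X f)\<^sup>2 \<le> ell2_inner X (\<lambda>x. T f x - z * f x) (\<lambda>x. c * f x)"
  shows "bounded_below X (\<lambda>f x. T f x - z * f x)"
proof (rule bounded_belowI[OF d])
  fix f assume f: "f \<in> ell2 X"
  let ?g = "\<lambda>x. T f x - z * f x"
  have "d * (ell2_norm X f)\<^sup>2 \<le> ell2_norm X ?g * ell2_norm X (\<lambda>x. c * f x)"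
    using form[OF f] ell2_Cauchy_Schwarz[OF bounded_operatorD(1)[OF bounded_operator_shift[OF T] f]
        ell2_scale[OF f], of z c]
    by linarith
  then have "ell2_norm X f * (d * ell2_norm X f) \<le> ell2_norm X f * ell2_norm X ?g"
    by (simp add: ell2_norm_scale c power2_eq_square algebra_simps)
  then show "d * ell2_norm X f \<le> ell2_norm X ?g"
    by (cases "ell2_norm X f = 0") (auto simp: mult_le_cancel_left less_le)
qed

lemma ell2_inner_shift:
  assumes T: "bounded_operator X T" and f: "f \<in> ell2 X"
  shows "ell2_inner X (\<lambda>x. T f x - complex_of_real a * f x) f
    = ell2_inner X (T f) f - a * (ell2_norm X f)\<^sup>2"
  using ell2_inner_diff_left[OF bounded_operatorD(1)[OF T f] ell2_scale[OF f, of a] f]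
  by (simp add: ell2_inner_real_scale_left ell2_norm_square)

lemma bounded_below_above_form:
  assumes T: "bounded_operator X T" and "b < a"
    and "\<And>f. f \<in> ell2 X \<Longrightarrow> ell2_inner X (T f) f \<le> b * (ell2_norm X f)\<^sup>2"
  shows "bounded_below X (\<lambda>f x. T f x - complex_of_real a * f x)"
proof (rule bounded_below_by_form[where d = "a - b" and c = "-1"])
  fix f assume f: "f \<in> ell2 X"
  have "ell2_inner X g (\<lambda>x. - 1 * f x) = - ell2_inner X g f" for g
    using ell2_inner_real_scale_left[of X "-1" f g] by (simp add: ell2_inner_commute)
  then show "(a - b) * (ell2_norm X f)\<^sup>2
      \<le> ell2_inner X (\<lambda>x. T f x - complex_of_real a * f x) (\<lambda>x. - 1 * f x)"
    using assms(3)[OF f] by (simp only: ell2_inner_shift[OF T f]) (simp add: algebra_simps)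
qed (use assms in simp_all)

lemma bounded_below_below_form:
  assumes T: "bounded_operator X T" and "a < b"
    and "\<And>f. f \<in> ell2 X \<Longrightarrow> b * (ell2_norm X f)\<^sup>2 \<le> ell2_inner X (T f) f"
  shows "bounded_below X (\<lambda>f x. T f x - complex_of_real a * f x)"
proof (rule bounded_below_by_form[where d = "b - a" and c = 1])
  fix f assume f: "f \<in> ell2 X"
  show "(b - a) * (ell2_norm X f)\<^sup>2
      \<le> ell2_inner X (\<lambda>x. T f x - complex_of_real a * f x) (\<lambda>x. 1 * f x)"
    using assms(3)[OF f] ell2_inner_shift[OF T f] by (simp add: algebra_simps)
qed (use assms in simp_all)

text \<open>
  The form of a symmetric operator is real, so the form of \<open>T - z\<close> has imaginary part
  \<open>- Im z \<parallel>f\<parallel>\<^sup>2\<close>; the unit \<open>- sgn (Im z) \<i>\<close> rotates it onto the positive axis.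
\<close>

lemma bounded_below_nonreal:
  assumes T: "bounded_operator X T" "symmetric_operator X T" and z: "Im z \<noteq> 0"
  shows "bounded_below X (\<lambda>f x. T f x - z * f x)"
proof (rule bounded_below_by_form[where d = "\<bar>Im z\<bar>" and c = "- complex_of_real (sgn (Im z)) * \<i>"])
  fix f assume f: "f \<in> ell2 X"
  let ?c = "- complex_of_real (sgn (Im z)) * \<i>"
  have cf: "(\<lambda>x. ?c * f x) \<in> ell2 X" by (rule ell2_scale[OF f])
  have "ell2_inner X (T f) (\<lambda>x. ?c * f x) = ell2_inner X f (\<lambda>x. ?c * T f x)"
    using T(2) f cf bounded_operatorD(3)[OF T(1) f, of ?c] by (simp only: symmetric_operator_def)
  also have "\<dots> = ell2_inner X (\<lambda>x. cnj ?c * f x) (T f)"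
    using ell2_inner_scale_left[of X "cnj ?c" f "T f"] by simp
  also have "\<dots> = - ell2_inner X (\<lambda>x. ?c * f x) (T f)"
    using ell2_inner_real_scale_left[of X "-1" "\<lambda>x. ?c * f x" "T f"] by simp
  finally have 0: "ell2_inner X (T f) (\<lambda>x. ?c * f x) = 0"
    by (simp add: ell2_inner_commute)
  have "ell2_inner X (\<lambda>x. z * f x) (\<lambda>x. ?c * f x) = ell2_inner X f (\<lambda>x. (cnj z * ?c) * f x)"
    by (simp add: ell2_inner_scale_left mult.assoc)
  also have "\<dots> = (\<Sum>\<^sub>\<infinity>x\<in>X. - \<bar>Im z\<bar> * (f x \<bullet> f x))"
    unfolding ell2_inner_def
    by (intro infsum_cong) (simp add: inner_complex_def algebra_simps abs_sgn)
  also have "\<dots> = - \<bar>Im z\<bar> * (ell2_norm X f)\<^sup>2"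
    unfolding infsum_cmult_right' by (simp add: ell2_norm_square ell2_inner_def)
  finally show "\<bar>Im z\<bar> * (ell2_norm X f)\<^sup>2
      \<le> ell2_inner X (\<lambda>x. T f x - z * f x) (\<lambda>x. ?c * f x)"
    using ell2_inner_diff_left[OF bounded_operatorD(1)[OF T(1) f] ell2_scale[OF f] cf] 0 by simp
qed (use T z in \<open>simp_all add: norm_mult sgn_if\<close>)

text \<open>
  Completing the square, the hypothesis says \<open>\<parallel>(T - c / 2) f\<parallel> \<ge> c / 2 \<parallel>f\<parallel>\<close>; moving the centre \<open>c / 2\<close>
  to \<open>a\<close> costs \<open>\<bar>a - c / 2\<bar> \<parallel>f\<parallel>\<close>.
\<close>

lemma bounded_below_in_gap:
  assumes T: "bounded_operator X T" and a: "0 < a" "a < c"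
    and gap: "\<And>f. f \<in> ell2 X \<Longrightarrow> c * ell2_inner X (T f) f \<le> (ell2_norm X (T f))\<^sup>2"
  shows "bounded_below X (\<lambda>f x. T f x - complex_of_real a * f x)"
proof (rule bounded_belowI[where c = "c / 2 - \<bar>a - c / 2\<bar>"])
  show "c / 2 - \<bar>a - c / 2\<bar> > 0" using a by (auto simp: abs_if)
next
  fix f assume f: "f \<in> ell2 X"
  note Tf = bounded_operatorD(1)[OF T f]
  let ?n = "ell2_norm X f"
  have "(ell2_norm X (\<lambda>x. T f x - complex_of_real (c / 2) * f x))\<^sup>2
      = (ell2_norm X (T f))\<^sup>2 - c * ell2_inner X (T f) f + (c / 2 * ?n)\<^sup>2"
    using a unfolding ell2_norm_square_diff[OF Tf ell2_scale[OF f]]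
      ell2_inner_commute[of X "T f"] ell2_inner_real_scale_left ell2_norm_scale norm_of_real
    by simp
  then have "(c / 2 * ?n)\<^sup>2 \<le> (ell2_norm X (\<lambda>x. T f x - complex_of_real (c / 2) * f x))\<^sup>2"
    using gap[OF f] by simp
  then have 1: "c / 2 * ?n \<le> ell2_norm X (\<lambda>x. T f x - complex_of_real (c / 2) * f x)"
    by (rule power2_le_imp_le) simp
  have 2: "ell2_norm X (\<lambda>x. T f x - complex_of_real (c / 2) * f x)
     \<le> ell2_norm X (\<lambda>x. T f x - complex_of_real a * f x) + \<bar>a - c / 2\<bar> * ?n"
  proof -
    have eq: "(\<lambda>x. T f x - complex_of_real (c / 2) * f x)
        = (\<lambda>x. (T f x - complex_of_real a * f x) + complex_of_real (a - c / 2) * f x)"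
      by (simp add: algebra_simps)
    have "ell2_norm X (\<lambda>x. complex_of_real (a - c / 2) * f x) = \<bar>a - c / 2\<bar> * ?n"
      by (simp only: ell2_norm_scale norm_of_real)
    then show ?thesis
      unfolding eq
      using ell2_norm_triangle[OF bounded_operatorD(1)[OF bounded_operator_shift[OF T] f, of a]
          ell2_scale[OF f, of "complex_of_real (a - c / 2)"]]
      by simp
  qed
  show "(c / 2 - \<bar>a - c / 2\<bar>) * ?n \<le> ell2_norm X (\<lambda>x. T f x - complex_of_real a * f x)"
    using 1 2 by (simp add: algebra_simps)
qed

section \<open>Radial functions\<close>

lemma absorb_square:
  fixes a d :: real
  shows "a ^ n * (a * d ^ Suc (Suc n))\<^sup>2 = (a * d\<^sup>2) * (a * d\<^sup>2) ^ Suc n"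
    and "a ^ n * (d ^ n)\<^sup>2 = (a * d\<^sup>2) ^ n"
  by (simp_all add: power_mult_distrib power2_eq_square mult_ac)

context equal_free_product
begin

definition words_of_length :: "nat \<Rightarrow> ('i \<times> 'a) list set" where
  "words_of_length n = {x \<in> X. length x = n}"

definition radial :: "(nat \<Rightarrow> complex) \<Rightarrow> ('i \<times> 'a) list \<Rightarrow> complex" where
  "radial \<phi> x = (if x \<in> X then \<phi> (length x) else 0)"

lemma words_of_length_0: "words_of_length 0 = {[]}"
  by (auto simp: words_of_length_def)

lemma words_of_length_Suc:
  "words_of_length (Suc n) = (\<lambda>(x, i, g). x @ [(i, g)]) `
     (SIGMA x : words_of_length n. SIGMA i : {i \<in> I. \<not> ends_in i x}. nontriv i)"
    (is "_ = ?f ` ?D")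
proof
  show "words_of_length (Suc n) \<subseteq> ?f ` ?D"
  proof
    fix y assume y: "y \<in> words_of_length (Suc n)"
    then obtain x i g where "y = x @ [(i, g)]"
      by (cases y rule: rev_cases) (auto simp: words_of_length_def)
    with y show "y \<in> ?f ` ?D"
      by (intro image_eqI[where x = "(x, i, g)"]) (auto simp: words_of_length_def reduced_words_snoc)
  qed
  show "?f ` ?D \<subseteq> words_of_length (Suc n)"
    by (auto simp: words_of_length_def reduced_words_snoc)
qed

lemma finite_words_of_length: "finite (words_of_length n)"
  by (induction n)
     (auto simp: words_of_length_0 words_of_length_Suc fin intro!: finite_imageI finite_SigmaI)

lemma card_words_of_length_Suc_sum:
  "real (card (words_of_length (Suc n))) = (\<Sum>x\<in>words_of_length n. if x = [] then (p + 1) * q else p * q)"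
proof -
  let ?K = "\<lambda>x. {i \<in> I. \<not> ends_in i x}"
  have "card (words_of_length (Suc n)) = card (SIGMA x : words_of_length n. SIGMA i : ?K x. nontriv i)"
    unfolding words_of_length_Suc by (rule card_image) (auto simp: inj_on_def)
  also have "\<dots> = (\<Sum>x\<in>words_of_length n. \<Sum>i\<in>?K x. card (nontriv i))"
  proof -
    have "card (SIGMA i : ?K x. nontriv i) = (\<Sum>i\<in>?K x. card (nontriv i))"
      for x :: "('i \<times> 'a) list"
      by (rule card_SigmaI) (use fin in auto)
    moreover have "card (SIGMA x : words_of_length n. SIGMA i : ?K x. nontriv i)
        = (\<Sum>x\<in>words_of_length n. card (SIGMA i : ?K x. nontriv i))"
      by (rule card_SigmaI) (use finite_words_of_length fin in \<open>auto intro!: finite_SigmaI\<close>)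
    ultimately show ?thesis by (simp only:)
  qed
  finally have "real (card (words_of_length (Suc n))) = (\<Sum>x\<in>words_of_length n. \<Sum>i\<in>?K x. real (card (nontriv i)))"
    by simp
  also have "\<dots> = (\<Sum>x\<in>words_of_length n. if x = [] then (p + 1) * q else p * q)"
  proof (rule sum.cong[OF refl])
    fix x assume "x \<in> words_of_length n"
    then have x: "x \<in> X" by (simp add: words_of_length_def)
    have "(\<Sum>i\<in>?K x. real (card (nontriv i))) = (\<Sum>i\<in>?K x. q)"
      by (intro sum.cong refl real_card_nontriv) simp
    also have "\<dots> = (\<Sum>i\<in>I. if ends_in i x then 0 else q)"
      unfolding sum.inter_filter[OF finite_I] by (intro sum.cong) auto
    also have "\<dots> = (if x = [] then (p + 1) * q else p * q)"
      unfolding sum_ends_in[OF x] by simp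
    finally show "(\<Sum>i\<in>?K x. real (card (nontriv i))) = (if x = [] then (p + 1) * q else p * q)" .
  qed
  finally show ?thesis .
qed

lemma card_words_of_length_Suc: "real (card (words_of_length (Suc n))) = (p + 1) * q * (p * q) ^ n"
proof (induction n)
  case 0
  then show ?case unfolding card_words_of_length_Suc_sum by (simp add: words_of_length_0)
next
  case (Suc n)
  have "real (card (words_of_length (Suc (Suc n)))) = (\<Sum>x\<in>words_of_length (Suc n). p * q)"
    unfolding card_words_of_length_Suc_sum[of "Suc n"] by (intro sum.cong) (auto simp: words_of_length_def)
  also have "\<dots> = real (card (words_of_length (Suc n))) * (p * q)"
    by (simp only: sum_constant)
  finally show ?case unfolding Suc by (simp only: power_Suc mult_ac)
qed

lemma radial_norm:
  assumes "\<And>n. n > N \<Longrightarrow> \<phi> n = 0"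
  shows "radial \<phi> \<in> ell2 X"
    and "(ell2_norm X (radial \<phi>))\<^sup>2 = (\<Sum>n\<le>N. real (card (words_of_length n)) * (cmod (\<phi> n))\<^sup>2)"
proof -
  let ?F = "\<Union>n\<le>N. words_of_length n"
  have F: "finite ?F" "?F \<subseteq> X" using finite_words_of_length by (auto simp: words_of_length_def)
  have zero: "radial \<phi> x = 0" if "x \<notin> ?F" for x
    using that assms by (auto simp: radial_def words_of_length_def not_le)
  show "radial \<phi> \<in> ell2 X"
    using F zero by (rule ell2_finite_support)
  have "(ell2_norm X (radial \<phi>))\<^sup>2 = (\<Sum>x\<in>?F. (cmod (radial \<phi> x))\<^sup>2)"
    using F zero by (rule ell2_finite_support)
  also have "\<dots> = (\<Sum>n\<le>N. \<Sum>x\<in>words_of_length n. (cmod (radial \<phi> x))\<^sup>2)"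
    using finite_words_of_length by (intro sum.UNION_disjoint) (auto simp: words_of_length_def)
  also have "\<dots> = (\<Sum>n\<le>N. \<Sum>x\<in>words_of_length n. (cmod (\<phi> n))\<^sup>2)"
    by (intro sum.cong refl) (auto simp: radial_def words_of_length_def)
  finally show "(ell2_norm X (radial \<phi>))\<^sup>2 = (\<Sum>n\<le>N. real (card (words_of_length n)) * (cmod (\<phi> n))\<^sup>2)"
    by simp
qed

lemma coset_sum_radial:
  assumes x: "x \<in> X" and i: "i \<in> I"
  shows "coset_sum i (radial \<phi>) x = (if ends_in i x
     then \<phi> (length x - 1) + of_real q * \<phi> (length x)
     else \<phi> (length x) + of_real q * \<phi> (Suc (length x)))"
proof -
  let ?u = "stem i x"
  have u: "?u \<in> X" "\<not> ends_in i ?u"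
    using stem_closed[OF x i] stem_not_ends_in[OF x i] .
  have "(\<Sum>g\<in>nontriv i. radial \<phi> (?u @ [(i, g)])) = (\<Sum>g\<in>nontriv i. \<phi> (Suc (length ?u)))"
    using u i by (intro sum.cong) (auto simp: radial_def reduced_words_snoc)
  also have "\<dots> = of_real (real (card (nontriv i))) * \<phi> (Suc (length ?u))"
    by simp
  also have "\<dots> = of_real q * \<phi> (Suc (length ?u))"
    unfolding real_card_nontriv[OF i] ..
  finally have "coset_sum i (radial \<phi>) x = \<phi> (length ?u) + of_real q * \<phi> (Suc (length ?u))"
    unfolding coset_sum_stem[OF x i] using u by (simp add: radial_def)
  moreover have "Suc (length x - 1) = length x" if "ends_in i x"
    using that by (cases x) (auto simp: ends_in_def)
  ultimately show ?thesis by (auto simp: stem_def)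
qed

text \<open>
  The profile of \<open>T\<close> applied to a radial function: a word of length \<open>Suc m\<close> is the stem of \<open>p\<close> cosets,
  each with \<open>q\<close> further words of length \<open>Suc (Suc m)\<close>, and lies in one coset whose stem has length \<open>m\<close>.
\<close>

definition radial_image :: "(nat \<Rightarrow> complex) \<Rightarrow> nat \<Rightarrow> complex" where
  "radial_image \<phi> n = (case n of
     0 \<Rightarrow> of_real (p + 1) * (\<phi> 0 + of_real q * \<phi> 1)
   | Suc m \<Rightarrow> of_real p * (\<phi> (Suc m) + of_real q * \<phi> (Suc (Suc m))) + (\<phi> m + of_real q * \<phi> (Suc m)))"

lemma T_radial: "T (radial \<phi>) = radial (radial_image \<phi>)"
proof
  fix x
  show "T (radial \<phi>) x = radial (radial_image \<phi>) x"
  proof (cases "x \<in> X")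
    case True
    have "T (radial \<phi>) x = (\<Sum>i\<in>I. if ends_in i x
        then \<phi> (length x - 1) + of_real q * \<phi> (length x)
        else \<phi> (length x) + of_real q * \<phi> (Suc (length x)))"
      unfolding T_def P_def using True by (intro sum.cong refl) (simp add: coset_sum_radial)
    then show ?thesis
      unfolding sum_ends_in[OF True] using True
      by (cases x) (simp_all add: radial_def radial_image_def scaleR_conv_of_real)
  qed (simp add: T_def P_def radial_def)
qed

definition truncated_power :: "complex \<Rightarrow> nat \<Rightarrow> nat \<Rightarrow> complex" where
  "truncated_power c N n = (if n \<le> N then c ^ n else 0)"

lemma truncated_power_norm:
  defines "\<rho> \<equiv> \<lambda>c. p * q * (cmod c)\<^sup>2"
  shows "radial (truncated_power c N) \<in> ell2 X"
    and "(ell2_norm X (radial (truncated_power c N)))\<^sup>2 = 1 + (p + 1) / p * (\<Sum>n<N. \<rho> c ^ Suc n)"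
proof -
  let ?\<phi> = "truncated_power c N"
  have *: "?\<phi> n = 0" if "n > N" for n using that by (simp add: truncated_power_def)
  show "radial ?\<phi> \<in> ell2 X" using * by (rule radial_norm)
  have "(ell2_norm X (radial ?\<phi>))\<^sup>2 = (\<Sum>n\<le>N. real (card (words_of_length n)) * (cmod (?\<phi> n))\<^sup>2)"
    using * by (rule radial_norm)
  also have "\<dots> = 1 + (\<Sum>n<N. real (card (words_of_length (Suc n))) * (cmod (?\<phi> (Suc n)))\<^sup>2)"
    by (simp add: sum.atMost_shift words_of_length_0 truncated_power_def)
  also have "(\<Sum>n<N. real (card (words_of_length (Suc n))) * (cmod (?\<phi> (Suc n)))\<^sup>2)
      = (\<Sum>n<N. (p + 1) / p * \<rho> c ^ Suc n)"
  proof (rule sum.cong[OF refl])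
    fix n assume "n \<in> {..<N}"
    then have "?\<phi> (Suc n) = c ^ Suc n" by (simp add: truncated_power_def)
    then have "(cmod (?\<phi> (Suc n)))\<^sup>2 = ((cmod c)\<^sup>2) ^ Suc n"
      by (simp only: norm_power power_mult[symmetric] mult.commute)
    then have "real (card (words_of_length (Suc n))) * (cmod (?\<phi> (Suc n)))\<^sup>2
        = (p + 1) * q * (p * q) ^ n * ((cmod c)\<^sup>2) ^ Suc n"
      by (simp only: card_words_of_length_Suc)
    also have "\<dots> = (p + 1) / p * ((p * q) ^ Suc n * ((cmod c)\<^sup>2) ^ Suc n)"
      using pq by (simp add: field_simps)
    finally show "real (card (words_of_length (Suc n))) * (cmod (?\<phi> (Suc n)))\<^sup>2 = (p + 1) / p * \<rho> c ^ Suc n"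
      unfolding \<rho>_def by (simp only: power_mult_distrib)
  qed
  finally show "(ell2_norm X (radial ?\<phi>))\<^sup>2 = 1 + (p + 1) / p * (\<Sum>n<N. \<rho> c ^ Suc n)"
    by (simp only: sum_distrib_left)
qed

text \<open>
  Below the truncation length, and away from \<open>n = 0\<close>, the profile \<open>c\<^sup>n\<close> satisfies the recursion of \<open>T\<close> with the eigenvalue \<open>\<tau>\<close>.  The defect
  therefore lives at the empty word, where the recursion is different, and at the two lengths next to
  the truncation.  There the number of words grows like \<open>(p q)\<^sup>n\<close> against \<open>\<bar>c\<bar>\<^sup>2\<^sup>n\<close>, whence the powers
  of \<open>\<rho>\<close>.
\<close>

lemma truncated_power_defect:
  fixes c :: complex and N :: nat
  assumes c: "c \<noteq> 0"
  defines "\<rho> \<equiv> p * q * (cmod c)\<^sup>2"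
    and "\<tau> \<equiv> (1 + of_real q * c) * (of_real p + 1 / c)"
    and "f \<equiv> radial (truncated_power c (Suc N))"
  shows "(ell2_norm X (\<lambda>x. T f x - \<tau> * f x))\<^sup>2
    = (cmod ((1 + of_real q * c) * (1 - 1 / c)))\<^sup>2 + (p + 1) * q * (\<rho> + 1) * \<rho> ^ Suc N"
proof -
  define p' where "p' = complex_of_real p"
  define q' where "q' = complex_of_real q"
  let ?\<phi> = "truncated_power c (Suc N)"
  define \<delta> where "\<delta> n = radial_image ?\<phi> n - \<tau> * ?\<phi> n" for n
  have \<tau>: "\<tau> = (1 + q' * c) * (p' + 1 / c)" by (simp add: \<tau>_def p'_def q'_def)
  have Suc: "radial_image \<phi> (Suc m) = p' * (\<phi> (Suc m) + q' * \<phi> (Suc (Suc m))) + (\<phi> m + q' * \<phi> (Suc m))"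
    for \<phi> m by (simp only: radial_image_def p'_def q'_def nat.case)
  have 0: "radial_image \<phi> 0 = (p' + 1) * (\<phi> 0 + q' * \<phi> 1)" for \<phi>
    by (simp only: radial_image_def p'_def q'_def nat.case of_real_add of_real_1)
  have \<delta>0: "\<delta> 0 = (1 + q' * c) * (1 - 1 / c)"
    unfolding \<delta>_def 0 \<tau> using c by (simp add: truncated_power_def field_simps)
  have inner: "\<delta> (Suc m) = 0" if "m < N" for m
    unfolding \<delta>_def Suc \<tau> using c that by (simp add: truncated_power_def field_simps)
  have edge: "\<delta> (Suc N) = - (p' * q') * c ^ Suc (Suc N)"
    unfolding \<delta>_def Suc \<tau> using c by (simp add: truncated_power_def field_simps)
  have outer: "\<delta> (Suc (Suc N)) = c ^ Suc N"
    unfolding \<delta>_def Suc by (simp add: truncated_power_def)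
  have far: "\<delta> n = 0" if "n > Suc (Suc N)" for n
    using that unfolding \<delta>_def by (cases n) (simp_all add: Suc truncated_power_def)
  have "(\<lambda>x. T f x - \<tau> * f x) = radial \<delta>"
    unfolding f_def T_radial by (auto simp: radial_def \<delta>_def)
  then have "(ell2_norm X (\<lambda>x. T f x - \<tau> * f x))\<^sup>2
      = (\<Sum>n\<le>Suc (Suc N). real (card (words_of_length n)) * (cmod (\<delta> n))\<^sup>2)"
    using radial_norm(2)[of "Suc (Suc N)" \<delta>] far by simp
  also have "\<dots> = (\<Sum>n\<in>{0, Suc N, Suc (Suc N)}. real (card (words_of_length n)) * (cmod (\<delta> n))\<^sup>2)"
  proof (rule sum.mono_neutral_right)
    show "\<forall>n\<in>{..Suc (Suc N)} - {0, Suc N, Suc (Suc N)}. real (card (words_of_length n)) * (cmod (\<delta> n))\<^sup>2 = 0"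
    proof
      fix n assume "n \<in> {..Suc (Suc N)} - {0, Suc N, Suc (Suc N)}"
      then obtain m where "n = Suc m" "m < N" by (cases n) auto
      then show "real (card (words_of_length n)) * (cmod (\<delta> n))\<^sup>2 = 0" using inner by simp
    qed
  qed auto
  also have "\<dots> = (cmod (\<delta> 0))\<^sup>2 + real (card (words_of_length (Suc N))) * (cmod (\<delta> (Suc N)))\<^sup>2
      + real (card (words_of_length (Suc (Suc N)))) * (cmod (\<delta> (Suc (Suc N))))\<^sup>2"
    by (simp add: words_of_length_0)
  also have "\<dots> = (cmod (\<delta> 0))\<^sup>2 + (p + 1) * q * (p * q) ^ N * (cmod (\<delta> (Suc N)))\<^sup>2
      + (p + 1) * q * (p * q) ^ Suc N * (cmod (\<delta> (Suc (Suc N))))\<^sup>2"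
    by (simp only: card_words_of_length_Suc)
  also have "cmod (\<delta> (Suc N)) = p * q * cmod c ^ Suc (Suc N)"
    unfolding edge p'_def q'_def using pq by (simp add: norm_mult norm_power abs_mult del: power_Suc of_real_diff)
  also have "cmod (\<delta> (Suc (Suc N))) = cmod c ^ Suc N"
    unfolding outer by (rule norm_power)
  also have "(p + 1) * q * (p * q) ^ N * (p * q * cmod c ^ Suc (Suc N))\<^sup>2
      = (p + 1) * q * \<rho> * \<rho> ^ Suc N"
    using absorb_square(1)[of "p * q" N "cmod c"] unfolding \<rho>_def power_Suc[symmetric] mult.assoc
    by simp
  also have "(p + 1) * q * (p * q) ^ Suc N * (cmod c ^ Suc N)\<^sup>2 = (p + 1) * q * \<rho> ^ Suc N"
    using absorb_square(2)[of "p * q" "Suc N" "cmod c"] unfolding \<rho>_def mult.assoc by simp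
  finally show ?thesis unfolding \<delta>0 q'_def by (simp add: algebra_simps)
qed

text \<open>
  If \<open>\<rho> = 1\<close>, the norms of the test functions grow without bound while the defect stays bounded.  If
  \<open>\<rho> < 1\<close> and \<open>1 + q c = 0\<close>, the defect at the empty word vanishes and the rest tends to zero, while the
  norms are at least one.
\<close>

lemma not_bounded_below_radial:
  fixes c :: complex
  assumes c: "c \<noteq> 0"
  defines "\<rho> \<equiv> p * q * (cmod c)\<^sup>2"
    and "\<tau> \<equiv> (1 + of_real q * c) * (of_real p + 1 / c)"
  assumes "\<rho> = 1 \<or> \<rho> < 1 \<and> 1 + of_real q * c = 0"
  shows "\<not> bounded_below X (\<lambda>f x. T f x - \<tau> * f x)"
proof
  assume "bounded_below X (\<lambda>f x. T f x - \<tau> * f x)"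
  then obtain k where k: "k > 0"
    "\<And>f. f \<in> ell2 X \<Longrightarrow> k * ell2_norm X f \<le> ell2_norm X (\<lambda>x. T f x - \<tau> * f x)"
    unfolding bounded_below_def by auto
  define e where "e = (cmod ((1 + of_real q * c) * (1 - 1 / c)))\<^sup>2"
  have main: "k\<^sup>2 * (1 + (p + 1) / p * (\<Sum>n<Suc N. \<rho> ^ Suc n))
      \<le> e + (p + 1) * q * (\<rho> + 1) * \<rho> ^ Suc N" for N
  proof -
    let ?f = "radial (truncated_power c (Suc N))"
    have "k * ell2_norm X ?f \<le> ell2_norm X (\<lambda>x. T ?f x - \<tau> * ?f x)"
      by (rule k(2)[OF truncated_power_norm(1)])
    then have "(k * ell2_norm X ?f)\<^sup>2 \<le> (ell2_norm X (\<lambda>x. T ?f x - \<tau> * ?f x))\<^sup>2"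
      using k(1) by (intro power_mono) auto
    then show ?thesis
      unfolding power_mult_distrib[of k] truncated_power_norm(2) \<tau>_def truncated_power_defect[OF c]
      unfolding \<rho>_def e_def .
  qed
  from assms(4) show False
  proof (elim disjE conjE)
    assume \<rho>: "\<rho> = 1"
    obtain N :: nat where N: "(e + (p + 1) * q * 2) / k\<^sup>2 < real N"
      using reals_Archimedean2 by blast
    have "real N \<le> real (Suc N)" by simp
    also have "\<dots> \<le> (p + 1) / p * real (Suc N)"
      using pq mult_right_mono[of 1 "(p + 1) / p" "real (Suc N)"] by simp
    finally have "k\<^sup>2 * real N \<le> k\<^sup>2 * (1 + (p + 1) / p * real (Suc N))"
      by (intro mult_left_mono) auto
    also have "\<dots> \<le> e + (p + 1) * q * 2"
      using main[of N] by (simp add: \<rho>)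
    finally show False using N k(1) by (simp add: field_simps)
  next
    assume \<rho>: "\<rho> < 1" and "1 + of_real q * c = 0"
    then have e: "e = 0" by (simp add: e_def)
    have \<rho>0: "\<rho> \<ge> 0" unfolding \<rho>_def using pq by simp
    have "(\<lambda>N. (p + 1) * q * (\<rho> + 1) * \<rho> ^ Suc N) \<longlonglongrightarrow> (p + 1) * q * (\<rho> + 1) * 0"
      using \<rho> \<rho>0 by (intro tendsto_mult tendsto_const LIMSEQ_Suc LIMSEQ_realpow_zero)
    then have "\<forall>\<^sub>F N in sequentially. (p + 1) * q * (\<rho> + 1) * \<rho> ^ Suc N < k\<^sup>2"
      using k(1) by (intro order_tendstoD(2)) auto
    then obtain N where N: "(p + 1) * q * (\<rho> + 1) * \<rho> ^ Suc N < k\<^sup>2"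
      using eventually_happens'[OF sequentially_bot] by blast
    have "k\<^sup>2 * 1 \<le> k\<^sup>2 * (1 + (p + 1) / p * (\<Sum>n<Suc N. \<rho> ^ Suc n))"
      using pq \<rho>0 by (intro mult_left_mono add_increasing2 mult_nonneg_nonneg sum_nonneg) auto
    with main[of N] N e show False by simp
  qed
qed

text \<open>
  On the circle \<open>\<bar>c\<bar> = 1 / \<surd>(p q)\<close>, where \<open>\<rho> = 1\<close>, the approximate eigenvalue
  \<open>(1 + q c) (p + 1 / c) = p + q + p q c + 1 / c\<close> is \<open>p + q + 2 \<surd>(p q) cos (arg c)\<close> and runs through the
  interval.  The value \<open>c = - 1 / q\<close> gives the eigenvalue zero, with \<open>\<rho> = p / q\<close>.
\<close>

theorem T_spectrum:
  "\<not> bounded_below X (\<lambda>f x. T f x - z * f x) \<longleftrightarrow>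
   z \<in> complex_of_real ` ({p + q - 2 * sqrt (p * q) .. p + q + 2 * sqrt (p * q)}
                          \<union> (if p < q then {0} else {}))"
proof
  let ?s = "sqrt (p * q)"
  assume z: "\<not> bounded_below X (\<lambda>f x. T f x - z * f x)"
  have "Im z = 0"
    using z bounded_below_nonreal[OF T_bounded T_symmetric] by blast
  then obtain a where a: "z = complex_of_real a"
    by (metis complex_is_Real_iff Reals_cases)
  have "a \<le> p + q + 2 * ?s"
    using z bounded_below_above_form[OF T_bounded _ T_upper] unfolding a by force
  moreover have "p + q - 2 * ?s \<le> a" if "q \<le> p"
    using z bounded_below_below_form[OF T_bounded _ T_lower[OF _ that]] unfolding a by force
  moreover have "a = 0 \<or> p + q - 2 * ?s \<le> a" if "p < q"
  proof -
    have "0 * (ell2_norm X f)\<^sup>2 \<le> ell2_inner X (T f) f" if "f \<in> ell2 X" for f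
      using T_nonneg[OF that] by simp
    then have "0 \<le> a"
      using z bounded_below_below_form[OF T_bounded, of a 0] unfolding a by force
    then show ?thesis
      using z bounded_below_in_gap[OF T_bounded _ _ T_gap[OF _ that], of a] unfolding a by force
  qed
  ultimately have "a \<in> {p + q - 2 * ?s .. p + q + 2 * ?s} \<union> (if p < q then {0} else {})"
    by (cases "p < q") auto
  then show "z \<in> complex_of_real ` ({p + q - 2 * ?s .. p + q + 2 * ?s} \<union> (if p < q then {0} else {}))"
    unfolding a by (rule imageI)
next
  define s where "s = sqrt (p * q)"
  have s: "s > 0" "s * s = p * q" using pq by (simp_all add: s_def)
  assume "z \<in> complex_of_real ` ({p + q - 2 * sqrt (p * q) .. p + q + 2 * sqrt (p * q)} \<union> (if p < q then {0} else {}))"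
  then consider a where "z = complex_of_real a" "p + q - 2 * s \<le> a" "a \<le> p + q + 2 * s"
    | "p < q" "z = 0"
    unfolding s_def[symmetric] by (auto split: if_splits)
  then show "\<not> bounded_below X (\<lambda>f x. T f x - z * f x)"
  proof cases
    case 1
    define u where "u = (a - p - q) / (2 * s)"
    have u: "-1 \<le> u" "u \<le> 1"
      using 1 s unfolding u_def by (simp_all only: pos_le_divide_eq pos_divide_le_eq mult_pos_pos zero_less_numeral)
    define c where "c = cis (arccos u) / of_real s"
    have c: "c \<noteq> 0" using s by (simp add: c_def)
    have "cmod c = 1 / s" using s by (simp add: c_def norm_divide)
    then have "s * s * (cmod c)\<^sup>2 = 1" using s(1) by (simp add: power2_eq_square)
    then have \<rho>: "p * q * (cmod c)\<^sup>2 = 1" unfolding s(2) .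
    have inv: "1 / c = of_real s * cis (- arccos u)"
      using s by (simp add: c_def divide_simps cis_mult)
    have "complex_of_real (p * q) * c = of_real s * cis (arccos u)"
      using s by (simp add: c_def s(2)[symmetric])
    then have "of_real p * of_real q * c + 1 / c = of_real s * (cis (arccos u) + cis (- arccos u))"
      unfolding inv by (simp only: of_real_mult distrib_left)
    also have "cis (arccos u) + cis (- arccos u) = of_real (2 * u)"
      using u by (simp add: complex_eq_iff)
    also have "of_real s * complex_of_real (2 * u) = of_real (a - p - q)"
      using s by (simp only: of_real_mult[symmetric] u_def) simp
    finally have "z = (1 + of_real q * c) * (of_real p + 1 / c)"
      using c unfolding 1 by (simp add: field_simps)
    then show ?thesis
      using not_bounded_below_radial[OF c] \<rho> by simp
  next
    case 2
    define c where "c = - 1 / complex_of_real q"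
    have c: "c \<noteq> 0" "1 + of_real q * c = 0" using pq by (simp_all add: c_def)
    have "cmod c = 1 / \<bar>q\<bar>"
      unfolding c_def norm_divide norm_of_real by simp
    then have "cmod c = 1 / q" using pq by simp
    then have "p * q * (cmod c)\<^sup>2 = p / q" using pq by (simp add: power2_eq_square)
    then have "p * q * (cmod c)\<^sup>2 < 1" using 2 pq by simp
    then show ?thesis
      using not_bounded_below_radial[OF c(1)] c(2) 2(2) by simp
  qed
qed


section \<open>The Laplacian\<close>

lemma emb_nontriv: "g \<in> nontriv i \<Longrightarrow> emb i g = [(i, g)]"
  by (simp add: free_product_inj_def)

lemma sum_generators: "(\<Sum>a\<in>S. F a) = (\<Sum>i\<in>I. \<Sum>g\<in>nontriv i. F (emb i g))"
proof -
  have "(\<Sum>a\<in>S. F a) = (\<Sum>i\<in>I. \<Sum>a\<in>emb i ` nontriv i. F a)"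
    unfolding free_product_generators_def
    using nontriv(1) by (intro sum.UNION_disjoint) (auto simp: emb_nontriv)
  also have "\<dots> = (\<Sum>i\<in>I. \<Sum>g\<in>nontriv i. F (emb i g))"
  proof (rule sum.cong[OF refl])
    fix i
    have "inj_on (emb i) (nontriv i)" by (auto simp: inj_on_def emb_nontriv)
    then show "(\<Sum>a\<in>emb i ` nontriv i. F a) = (\<Sum>g\<in>nontriv i. F (emb i g))"
      by (simp add: sum.reindex)
  qed
  finally show ?thesis .
qed

lemma card_generators: "real (card S) = real r * q"
proof -
  have "real (card S) = (\<Sum>a\<in>S. 1)" by simp
  also have "\<dots> = (\<Sum>i\<in>I. real (card (nontriv i)))" unfolding sum_generators by simp
  also have "\<dots> = (\<Sum>i\<in>I. q)" by (intro sum.cong refl real_card_nontriv)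
  finally show ?thesis using r by simp
qed

text \<open>
  The sum over \<open>S\<close> runs over all cosets of \<open>x\<close> with \<open>x\<close> itself left out, so it is \<open>T f x - r f x\<close>.
\<close>

lemma laplacian_T:
  assumes f: "f \<in> ell2 X"
  shows "cayley_laplacian A S f x - z * f x
    = of_real (- 1 / (real r * q)) * (T f x - (of_nat r + of_real (real r * q) * (1 - z)) * f x)"
proof (cases "x \<in> X")
  case True
  have "(\<Sum>a\<in>S. f (x \<otimes>\<^bsub>A\<^esub> a)) = (\<Sum>i\<in>I. coset_sum i f x - f x)"
    unfolding sum_generators
  proof (rule sum.cong[OF refl])
    fix i assume i: "i \<in> I"
    have "x \<otimes>\<^bsub>A\<^esub> emb i \<one>\<^bsub>G i\<^esub> = x"
      using A.r_one[of x] True by (simp add: free_product_inj_def free_product_def)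
    then show "(\<Sum>g\<in>nontriv i. f (x \<otimes>\<^bsub>A\<^esub> emb i g)) = coset_sum i f x - f x"
      unfolding coset_sum_def by (simp add: sum.remove[OF fin[OF i] one_closed_factor[OF i]])
  qed
  also have "\<dots> = T f x - of_nat r * f x"
    using True r by (simp add: T_def P_def sum_subtractf)
  finally have sum: "(\<Sum>a\<in>S. f (x \<otimes>\<^bsub>A\<^esub> a)) = T f x - of_nat r * f x" .
  have "of_nat (card S) = complex_of_real (real r * q)"
    using card_generators by (metis of_real_of_nat_eq)
  moreover have "complex_of_real (real r * q) \<noteq> 0" using r pq by simp
  ultimately show ?thesis
    unfolding cayley_laplacian_def sum using True
    by (simp only: carrier_A if_True) (simp add: field_simps)
next
  case False
  then show ?thesis
    using ell2_vanishes[OF f False] by (simp add: cayley_laplacian_def T_def P_def)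
qed

end


lemma bounded_below_scale:
  assumes c: "c \<noteq> 0" and eq: "\<And>f. f \<in> ell2 X \<Longrightarrow> D f = (\<lambda>x. c * T f x)"
  shows "bounded_below X D \<longleftrightarrow> bounded_below X T"
proof
  assume "bounded_below X D"
  then obtain k where k: "k > 0" "\<And>f. f \<in> ell2 X \<Longrightarrow> k * ell2_norm X f \<le> ell2_norm X (D f)"
    unfolding bounded_below_def by auto
  show "bounded_below X T"
  proof (rule bounded_belowI[where c = "k / cmod c"])
    show "k / cmod c > 0" using k c by simp
    fix f assume "f \<in> ell2 X"
    from k(2)[OF this] show "k / cmod c * ell2_norm X f \<le> ell2_norm X (T f)"
      unfolding eq[OF \<open>f \<in> ell2 X\<close>] ell2_norm_scale using c by (simp add: field_simps)
  qed
next
  assume "bounded_below X T"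
  then obtain k where k: "k > 0" "\<And>f. f \<in> ell2 X \<Longrightarrow> k * ell2_norm X f \<le> ell2_norm X (T f)"
    unfolding bounded_below_def by auto
  show "bounded_below X D"
  proof (rule bounded_belowI[where c = "cmod c * k"])
    show "cmod c * k > 0" using k c by simp
    fix f assume "f \<in> ell2 X"
    from k(2)[OF this] show "cmod c * k * ell2_norm X f \<le> ell2_norm X (D f)"
      unfolding eq[OF \<open>f \<in> ell2 X\<close>] ell2_norm_scale using c by (simp add: mult.assoc)
  qed
qed

lemma real_affine_symmetric:
  fixes c a :: real
  assumes T: "bounded_operator X T" "symmetric_operator X T"
    and D: "\<And>f. f \<in> ell2 X \<Longrightarrow> D f = (\<lambda>x. complex_of_real c * (T f x - complex_of_real a * f x))"
  shows "bounded_operator X D" "symmetric_operator X D"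
proof -
  let ?H = "\<lambda>f x. T f x - complex_of_real a * f x"
  have H: "bounded_operator X ?H" by (rule bounded_operator_shift[OF T(1)])
  obtain K where K: "\<And>f. f \<in> ell2 X \<Longrightarrow> ell2_norm X (?H f) \<le> K * ell2_norm X f"
    using bounded_operator_bound[OF H] by metis
  show "bounded_operator X D"
    unfolding bounded_operator_def
  proof (intro conjI ballI allI exI[of _ "\<bar>c\<bar> * K"])
    fix f assume f: "f \<in> ell2 X"
    show "D f \<in> ell2 X"
      unfolding D[OF f] by (rule ell2_scale[OF bounded_operatorD(1)[OF H f]])
    show "ell2_norm X (D f) \<le> \<bar>c\<bar> * K * ell2_norm X f"
      unfolding D[OF f] ell2_norm_scale using mult_left_mono[OF K[OF f], of "\<bar>c\<bar>"]
      by (simp add: mult.assoc)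
    show "D (\<lambda>x. b * f x) = (\<lambda>x. b * D f x)" for b
      unfolding D[OF f] D[OF ell2_scale[OF f]] bounded_operatorD(3)[OF T(1) f] by (simp add: algebra_simps)
    fix g assume g: "g \<in> ell2 X"
    show "D (\<lambda>x. f x + g x) = (\<lambda>x. D f x + D g x)"
      unfolding D[OF f] D[OF g] D[OF ell2_add[OF f g]] bounded_operatorD(2)[OF T(1) f g]
      by (simp add: algebra_simps)
  qed
  show "symmetric_operator X D"
    unfolding symmetric_operator_def
  proof (intro ballI)
    fix f g assume f: "f \<in> ell2 X" and g: "g \<in> ell2 X"
    show "ell2_inner X (D f) g = ell2_inner X f (D g)"
      unfolding D[OF f] D[OF g] ell2_inner_commute[of X f "\<lambda>x. complex_of_real c * (T g x - complex_of_real a * g x)"]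
        ell2_inner_real_scale_left
      using symmetric_shift_adjoint[OF T f g, of "complex_of_real a"]
      by (simp add: ell2_inner_commute[of X f])
  qed
qed

theorem corollary1p1:
  fixes r L :: nat and G :: "nat \<Rightarrow> ('a, 'b) monoid_scheme"
  assumes "r \<ge> 2" and "L \<ge> 2"
    and "\<And>i. i \<in> {1..r} \<Longrightarrow> group (G i)"
    and "\<And>i. i \<in> {1..r} \<Longrightarrow> finite (carrier (G i))"
    and "\<And>i. i \<in> {1..r} \<Longrightarrow> order (G i) = L"
  defines "A \<equiv> free_product {1..r} G"
    and "S \<equiv> free_product_generators {1..r} G"
  shows "operator_spectrum (carrier A) (cayley_laplacian A S) =
    complex_of_real `
      ({1 - (real L - 2 + 2 * sqrt ((real r - 1) * (real L - 1))) / (real r * (real L - 1)) ..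
        1 - (real L - 2 - 2 * sqrt ((real r - 1) * (real L - 1))) / (real r * (real L - 1))}
       \<union> (if L > r then {real L / (real L - 1)} else {}))"
proof -
  interpret F: equal_free_product "{1..r}" r L G
    by (rule equal_free_product.intro) (use assms(1-5) in simp_all)
  define X where "X = carrier A"
  define p where "p = real r - 1"
  define q where "q = real L - 1"
  define s where "s = sqrt (p * q)"
  define m where "m = real r * q"
  have m: "m > 0" "real r = p + 1" "real L = q + 1" "m = (p + 1) * q" "p > 0" "q > 0"
    using assms(1,2) by (simp_all add: m_def p_def q_def)
  define D where "D = cayley_laplacian A S"
  define \<tau> where "\<tau> z = of_nat r + of_real m * (1 - z)" for z :: complex
  have lap: "D f x - z * f x = of_real (- 1 / m) * (F.T f x - \<tau> z * f x)" if "f \<in> ell2 X" for f x z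
    using F.laplacian_T[of f x z] that
    unfolding X_def A_def S_def D_def \<tau>_def m_def q_def F.carrier_A by blast
  have T: "bounded_operator X F.T" "symmetric_operator X F.T"
    using F.T_bounded F.T_symmetric by (simp_all only: X_def A_def F.carrier_A)
  have D0: "D f = (\<lambda>x. of_real (- 1 / m) * (F.T f x - of_real (real r + m) * f x))" if "f \<in> ell2 X" for f
  proof
    fix x
    show "D f x = of_real (- 1 / m) * (F.T f x - of_real (real r + m) * f x)"
      using lap[OF that, of x 0] unfolding \<tau>_def by simp
  qed
  note D = real_affine_symmetric[OF T D0]
  have "z \<in> operator_spectrum X D \<longleftrightarrow> \<not> bounded_below X (\<lambda>f x. F.T f x - \<tau> z * f x)" for z
  proof -
    have "bounded_below X (\<lambda>f x. D f x - z * f x) \<longleftrightarrow> bounded_below X (\<lambda>f x. F.T f x - \<tau> z * f x)"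
    proof (rule bounded_below_scale)
      show "complex_of_real (- 1 / m) \<noteq> 0" using m(1) by simp
      show "(\<lambda>x. D f x - z * f x) = (\<lambda>x. complex_of_real (- 1 / m) * (F.T f x - \<tau> z * f x))"
        if "f \<in> ell2 X" for f
        using lap[OF that] by blast
    qed
    then show ?thesis using symmetric_spectrum[OF D, of z] by blast
  qed
  then have spec: "z \<in> operator_spectrum X D \<longleftrightarrow>
      \<tau> z \<in> complex_of_real ` ({p + q - 2 * s .. p + q + 2 * s} \<union> (if p < q then {0} else {}))" for z
    using F.T_spectrum[of "\<tau> z"]
    unfolding X_def A_def F.carrier_A p_def[symmetric] q_def[symmetric] s_def[symmetric] by blast
  let ?B = "{1 - (q - 1 + 2 * s) / m .. 1 - (q - 1 - 2 * s) / m} \<union> (if p < q then {(q + 1) / q} else {})"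
  have real: "p + 1 + m * (1 - y) \<in> {p + q - 2 * s .. p + q + 2 * s} \<union> (if p < q then {0} else {})
      \<longleftrightarrow> y \<in> ?B" for y :: real
  proof -
    have "p + q - 2 * s \<le> p + 1 + m * (1 - y) \<longleftrightarrow> y \<le> 1 - (q - 1 - 2 * s) / m"
      "p + 1 + m * (1 - y) \<le> p + q + 2 * s \<longleftrightarrow> 1 - (q - 1 + 2 * s) / m \<le> y"
      using m(1) by (simp_all add: field_simps)
    moreover have "p + 1 + m * (1 - y) = 0 \<longleftrightarrow> y = (q + 1) / q"
    proof -
      have "p + 1 + m * (1 - y) = (p + 1) * (1 + q * (1 - y))" by (simp add: m(4) algebra_simps)
      then have "p + 1 + m * (1 - y) = 0 \<longleftrightarrow> 1 + q * (1 - y) = 0" using m(5) by simp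
      also have "\<dots> \<longleftrightarrow> y = (q + 1) / q" using m(6) by (auto simp: field_simps)
      finally show ?thesis .
    qed
    ultimately show ?thesis by auto
  qed
  have rc: "of_nat r = complex_of_real (p + 1)"
    unfolding m(2)[symmetric] by (rule of_real_of_nat_eq[symmetric])
  have \<tau>_real: "\<tau> (complex_of_real y) = complex_of_real (p + 1 + m * (1 - y))" for y
    unfolding \<tau>_def rc by simp
  have inv: "z = of_real (1 - (t - (p + 1)) / m)" if "\<tau> z = complex_of_real t" for z t
  proof -
    have "complex_of_real m * z = complex_of_real (p + 1 + m - t)"
      using that unfolding \<tau>_def rc by (simp add: algebra_simps)
    then have "z = complex_of_real (p + 1 + m - t) / complex_of_real m"
      using m(1) by (simp add: field_simps)
    also have "\<dots> = complex_of_real ((p + 1 + m - t) / m)" by (rule of_real_divide[symmetric])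
    also have "(p + 1 + m - t) / m = 1 - (t - (p + 1)) / m"
      using m(1) by (simp add: field_simps)
    finally show ?thesis .
  qed
  have "operator_spectrum X D = complex_of_real ` ?B"
  proof (rule Set.set_eqI)
    fix z
    show "z \<in> operator_spectrum X D \<longleftrightarrow> z \<in> complex_of_real ` ?B"
    proof (cases "\<exists>y. z = complex_of_real y")
      case True
      then obtain y where y: "z = complex_of_real y" ..
      show ?thesis
        unfolding spec unfolding y \<tau>_real inj_image_mem_iff[OF inj_of_real] by (rule real)
    next
      case False
      then have "\<tau> z \<notin> range complex_of_real" using inv by blast
      then show ?thesis unfolding spec using False by blast
    qed
  qed
  moreover have "p < q \<longleftrightarrow> L > r" by (simp add: p_def q_def)
  moreover have "q - 1 = real L - 2" "q + 1 = real L" by (simp_all add: q_def)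
  ultimately show ?thesis
    unfolding X_def D_def m_def s_def by (simp only: p_def q_def)
qed

end
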